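(* Let $\mathcal Q_\varepsilon$ denote the family of $\varepsilon$-differentially private channels. Then for a constant $c_d>0$ that may depend on the dimension $d$, $$\inf_{Q\in\mathcal Q_\varepsilon}\ \sup_{P\in\mathcal P}\ \mathbb E_{P,Q}\left[\big\|\widehat f-f_P\big\|_2^2\right]\ \ge\ c_d\left[\frac{1}{n^{\frac{2}{2+d}}}+\frac{1}{(n\varepsilon)^{\frac{2}{1+d}}}\right].$$
   Context: $\mathcal P$ is the family of probability distributions $P$ supported on $[0,1]^d$ having a density $f_P$ (with respect to Lebesgue measure) that is $1$-Lipschitz continuous with respect to the $\ell_2$-norm on $\mathbb R^d$. The loss is $\|\widehat f-f\|_2^2=\int_{[0,1]^d}(\widehat f(t)-f(t))^2\,dt$. A channel $Q$ is a Markov kernel from $([0,1]^d)^n$ to $L^2([0,1]^d)$. Given $P$ and $Q$, $X_1,\dots,X_n$ are drawn i.i.d. from $P$, and conditionally on $X_{1:n}=(X_1,\dots,X_n)$ the estimator $\widehat f$ is drawn from $Q(\cdot\mid X_{1:n})$; $\mathbb E_{P,Q}$ is expectation over both. A channel $Q$ is $\varepsilon$-differentially private if $Q(A\mid x_{1:n})\le e^{\varepsilon}Q(A\mid x'_{1:n})$ for all measurable $A$ and all $x_{1:n},x'_{1:n}$ differing in only one observation.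
   Formalization: The bound is proved under the added condition nε ≥ 1; without a lower limit on nε it fails, since the constant estimator equal to 1 is ε-differentially private with risk at most d, while the right-hand side tends to infinity as nε → 0. *)

theory Defs
  imports "HOL-Probability.Probability"
begin

definition unit_cube :: "(real^'d) set"
  where "unit_cube = cbox 0 1"

definition cube_measure :: "(real^'d) measure"
  where "cube_measure = restrict_space lborel unit_cube"

lemma space_cube_measure [simp]: "space cube_measure = unit_cube"
  by (simp add: cube_measure_def space_restrict_space)

lemma emeasure_cube_measure_space: "emeasure cube_measure (unit_cube :: (real^'d) set) = 1"
proof -
  have "1 \<bullet> b = 1" if "b \<in> Basis" for b :: "real^'d"
    using that by (auto simp: Basis_vec_def inner_axis)
  then show ?thesis
    by (simp add: cube_measure_def unit_cube_def emeasure_restrict_space emeasure_lborel_cbox_eq)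
qed

interpretation cube_measure: prob_space "cube_measure :: (real^'d) measure"
  by standard (simp add: emeasure_cube_measure_space)


subsection \<open>The Hilbert space of square-integrable functions on the cube\<close>

definition square_integrable :: "(real^'d \<Rightarrow> real) \<Rightarrow> bool"
  where "square_integrable f \<longleftrightarrow>
    f \<in> borel_measurable cube_measure \<and> integrable cube_measure (\<lambda>t. (f t)\<^sup>2)"

lemma square_integrable_mult:
  assumes "square_integrable f" "square_integrable g"
  shows "integrable cube_measure (\<lambda>t. f t * g t)"
proof (rule Bochner_Integration.integrable_bound)
  show "integrable cube_measure (\<lambda>t. (f t)\<^sup>2 + (g t)\<^sup>2)"
    using assms by (auto simp: square_integrable_def)
  show "(\<lambda>t. f t * g t) \<in> borel_measurable cube_measure"
    using assms by (auto simp: square_integrable_def)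
  have "norm (a * b) \<le> norm (a\<^sup>2 + b\<^sup>2)" for a b :: real
  proof -
    have "2 * (\<bar>a\<bar> * \<bar>b\<bar>) \<le> a\<^sup>2 + b\<^sup>2"
      using sum_squares_bound[of "\<bar>a\<bar>" "\<bar>b\<bar>"] by (simp add: mult.assoc)
    moreover have "0 \<le> \<bar>a\<bar> * \<bar>b\<bar>"
      by simp
    ultimately have "\<bar>a\<bar> * \<bar>b\<bar> \<le> a\<^sup>2 + b\<^sup>2"
      by linarith
    then show ?thesis
      by (simp add: abs_mult)
  qed
  then show "AE t in cube_measure. norm (f t * g t) \<le> norm ((f t)\<^sup>2 + (g t)\<^sup>2)"
    by simp
qed

lemma square_integrable_add:
  assumes "square_integrable f" "square_integrable g"
  shows "square_integrable (\<lambda>t. f t + g t)"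
  using assms square_integrable_mult[OF assms]
  by (auto simp: square_integrable_def power2_sum mult.assoc)

lemma square_integrable_scale:
  "square_integrable f \<Longrightarrow> square_integrable (\<lambda>t. c * f t)"
  by (auto simp: square_integrable_def power_mult_distrib)

lemma square_integrable_zero: "square_integrable (\<lambda>_. 0)"
  by (simp add: square_integrable_def)

definition cube_L2_rel :: "(real^'d \<Rightarrow> real) \<Rightarrow> (real^'d \<Rightarrow> real) \<Rightarrow> bool"
  where "cube_L2_rel f g \<longleftrightarrow>
    square_integrable f \<and> square_integrable g \<and> (AE t in cube_measure. f t = g t)"

quotient_type (overloaded) 'd cube_L2 = "(real^'d::finite) \<Rightarrow> real" / partial: cube_L2_rel
  morphisms rep_cube_L2 to_cube_L2
proof (rule part_equivpI)
  show "\<exists>f::real^'d \<Rightarrow> real. cube_L2_rel f f"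
    using square_integrable_zero by (auto simp: cube_L2_rel_def)
  show "symp cube_L2_rel"
    by (auto simp: symp_def cube_L2_rel_def)
  show "transp cube_L2_rel"
    by (auto simp: transp_def cube_L2_rel_def)
qed

instantiation cube_L2 :: (finite) real_vector
begin

lift_definition zero_cube_L2 :: "'a cube_L2" is "\<lambda>_. 0"
  by (simp add: cube_L2_rel_def square_integrable_zero)

lift_definition plus_cube_L2 :: "'a cube_L2 \<Rightarrow> 'a cube_L2 \<Rightarrow> 'a cube_L2" is "\<lambda>f g t. f t + g t"
  by (auto simp: cube_L2_rel_def square_integrable_add)

lift_definition scaleR_cube_L2 :: "real \<Rightarrow> 'a cube_L2 \<Rightarrow> 'a cube_L2" is "\<lambda>c f t. c * f t"
  by (auto simp: cube_L2_rel_def square_integrable_scale)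

definition uminus_cube_L2 :: "'a cube_L2 \<Rightarrow> 'a cube_L2"
  where "uminus_cube_L2 f = (-1) *\<^sub>R f"

definition minus_cube_L2 :: "'a cube_L2 \<Rightarrow> 'a cube_L2 \<Rightarrow> 'a cube_L2"
  where "minus_cube_L2 f g = f + (-1) *\<^sub>R g"

instance
proof
  fix a b c :: "'a cube_L2" and r s :: real
  show "a + b + c = a + (b + c)"
    by transfer (auto simp: cube_L2_rel_def add.assoc intro!: square_integrable_add)
  show "a + b = b + a"
    by transfer (auto simp: cube_L2_rel_def add.commute intro!: square_integrable_add)
  show "0 + a = a"
    by transfer (auto simp: cube_L2_rel_def)
  show "- a + a = 0"
    unfolding uminus_cube_L2_def
    by transfer (auto simp: cube_L2_rel_def square_integrable_zero)
  show "a - b = a + - b"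
    by (simp add: uminus_cube_L2_def minus_cube_L2_def)
  show "r *\<^sub>R (a + b) = r *\<^sub>R a + r *\<^sub>R b"
    by transfer (auto simp: cube_L2_rel_def distrib_left
        intro!: square_integrable_add square_integrable_scale)
  show "(r + s) *\<^sub>R a = r *\<^sub>R a + s *\<^sub>R a"
    by transfer (auto simp: cube_L2_rel_def distrib_right
        intro!: square_integrable_add square_integrable_scale)
  show "r *\<^sub>R s *\<^sub>R a = (r * s) *\<^sub>R a"
    by transfer (auto simp: cube_L2_rel_def mult.assoc intro!: square_integrable_scale)
  show "1 *\<^sub>R a = a"
    by transfer (auto simp: cube_L2_rel_def)
qed

end

instantiation cube_L2 :: (finite) real_inner
begin

lift_definition inner_cube_L2 :: "'a cube_L2 \<Rightarrow> 'a cube_L2 \<Rightarrow> real"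
  is "\<lambda>f g. \<integral>t. f t * g t \<partial>cube_measure"
  by (rule integral_cong_AE) (auto simp: cube_L2_rel_def square_integrable_def)

definition norm_cube_L2 :: "'a cube_L2 \<Rightarrow> real"
  where "norm_cube_L2 f = sqrt (inner f f)"

definition sgn_cube_L2 :: "'a cube_L2 \<Rightarrow> 'a cube_L2"
  where "sgn_cube_L2 f = f /\<^sub>R norm f"

definition dist_cube_L2 :: "'a cube_L2 \<Rightarrow> 'a cube_L2 \<Rightarrow> real"
  where "dist_cube_L2 f g = norm (f - g)"

definition uniformity_cube_L2 :: "('a cube_L2 \<times> 'a cube_L2) filter"
  where "uniformity_cube_L2 = (INF e\<in>{0<..}. principal {(f, g). dist f g < e})"

definition open_cube_L2 :: "'a cube_L2 set \<Rightarrow> bool"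
  where "open_cube_L2 U \<longleftrightarrow> (\<forall>f\<in>U. eventually (\<lambda>(f', g). f' = f \<longrightarrow> g \<in> U) uniformity)"

instance
proof
  fix x y z :: "'a cube_L2" and r :: real and U :: "'a cube_L2 set"
  show "inner x y = inner y x"
    by transfer (simp add: mult.commute)
  show "inner (x + y) z = inner x z + inner y z"
    by transfer (auto simp: cube_L2_rel_def distrib_right square_integrable_mult)
  show "inner (r *\<^sub>R x) y = r * inner x y"
    by transfer (simp add: mult.assoc)
  show "0 \<le> inner x x"
    by transfer simp
  show "inner x x = 0 \<longleftrightarrow> x = 0"
  proof transfer
    fix f :: "real^'a \<Rightarrow> real"
    assume "cube_L2_rel f f"
    then have f: "square_integrable f"
      by (simp add: cube_L2_rel_def)
    have "(\<integral>t. f t * f t \<partial>cube_measure) = 0 \<longleftrightarrow> (AE t in cube_measure. f t * f t = 0)"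
      using square_integrable_mult[OF f f] by (intro integral_nonneg_eq_0_iff_AE) auto
    then show "(\<integral>t. f t * f t \<partial>cube_measure) = 0 \<longleftrightarrow> cube_L2_rel f (\<lambda>_. 0)"
      using f by (simp add: cube_L2_rel_def square_integrable_zero)
  qed
qed (simp_all add: norm_cube_L2_def sgn_cube_L2_def dist_cube_L2_def uniformity_cube_L2_def
    open_cube_L2_def)

end

lemma norm_diff_to_cube_L2:
  assumes "square_integrable f" "square_integrable g"
  shows "(norm (to_cube_L2 f - to_cube_L2 g))\<^sup>2 = (\<integral>t. (f t - g t)\<^sup>2 \<partial>cube_measure)"
proof -
  have f: "cube_L2_rel f f" and g: "cube_L2_rel g g"
    and g': "cube_L2_rel (\<lambda>t. (-1) * g t) (\<lambda>t. (-1) * g t)"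
    and h: "cube_L2_rel (\<lambda>t. f t + (-1) * g t) (\<lambda>t. f t + (-1) * g t)"
    using assms square_integrable_add[OF assms(1) square_integrable_scale[OF assms(2), of "-1"]]
      square_integrable_scale[OF assms(2), of "-1"]
    by (auto simp: cube_L2_rel_def)
  have "to_cube_L2 f - to_cube_L2 g = to_cube_L2 (\<lambda>t. f t + (-1) * g t)"
    unfolding minus_cube_L2_def scaleR_cube_L2.abs_eq[OF g] plus_cube_L2.abs_eq[OF f g'] ..
  then show ?thesis
    using inner_cube_L2.abs_eq[OF h h] by (simp only: power2_norm_eq_inner) (simp add: power2_eq_square)
qed


subsection \<open>Distributions with Lipschitz density\<close>

text \<open>Distributions live on the cube itself, and only the values of \<open>f\<close> on the cube matter. The Lipschitz condition cannot be imposed on all of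
  \<open>\<real>\<^sup>d\<close> for a density vanishing off the cube: such a function is at most
  \<open>1/2\<close> and cannot integrate to \<open>1\<close>.\<close>

definition lipschitz_density :: "(real^'d) measure \<Rightarrow> (real^'d \<Rightarrow> real) \<Rightarrow> bool"
  where "lipschitz_density P f \<longleftrightarrow>
    1-lipschitz_on unit_cube f \<and> (\<forall>t\<in>unit_cube. 0 \<le> f t) \<and>
    P = density cube_measure (\<lambda>t. ennreal (f t))"

definition lipschitz_distributions :: "(real^'d) measure set"
  where "lipschitz_distributions = {P. prob_space P \<and> (\<exists>f. lipschitz_density P f)}"

text \<open>The chosen density is unique on the cube up to null sets, see
  \<open>lipschitz_density_unique\<close> below.\<close>

definition density_of :: "(real^'d) measure \<Rightarrow> real^'d \<Rightarrow> real"
  where "density_of P = (SOME f. lipschitz_density P f)"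

lemma lipschitz_density_measurable:
  assumes "lipschitz_density P f"
  shows "f \<in> borel_measurable cube_measure"
proof -
  have "continuous_on unit_cube f"
    using assms lipschitz_on_continuous_on by (auto simp: lipschitz_density_def)
  then have "f \<in> borel_measurable (restrict_space borel unit_cube)"
    by (rule borel_measurable_continuous_on_restrict)
  moreover have "sets (restrict_space borel unit_cube) = sets cube_measure"
    unfolding cube_measure_def by (intro sets_restrict_space_cong) simp
  ultimately show ?thesis
    using measurable_cong_sets by blast
qed

lemma lipschitz_density_square_integrable:
  assumes "lipschitz_density P f"
  shows "square_integrable f"
proof -
  have "continuous_on unit_cube f"
    using assms lipschitz_on_continuous_on by (auto simp: lipschitz_density_def)
  then have "bounded (f ` unit_cube)"
    by (intro compact_imp_bounded compact_continuous_image) (auto simp: unit_cube_def)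
  then obtain B where "\<And>t. t \<in> unit_cube \<Longrightarrow> \<bar>f t\<bar> \<le> B"
    by (auto simp: bounded_iff)
  then have "(f t)\<^sup>2 \<le> B\<^sup>2" if "t \<in> unit_cube" for t
    using that power_mono[of "\<bar>f t\<bar>" B 2] by simp
  then have "AE t in cube_measure. norm ((f t)\<^sup>2) \<le> B\<^sup>2"
    by (intro AE_I2) simp
  with lipschitz_density_measurable[OF assms] show ?thesis
    unfolding square_integrable_def by (auto intro!: cube_measure.integrable_const_bound)
qed

lemma lipschitz_density_unique:
  assumes "lipschitz_density P f" "lipschitz_density P g"
  shows "to_cube_L2 f = to_cube_L2 g"
proof -
  have eq: "density cube_measure (\<lambda>t. ennreal (f t)) = density cube_measure (\<lambda>t. ennreal (g t))"
    using assms by (simp add: lipschitz_density_def)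
  have "AE t in cube_measure. ennreal (f t) = ennreal (g t)"
    using eq lipschitz_density_measurable[OF assms(1)] lipschitz_density_measurable[OF assms(2)]
    by (subst (asm) cube_measure.density_unique_iff) auto
  then have "AE t in cube_measure. f t = g t"
    by (rule AE_mp) (use assms in \<open>auto intro!: AE_I2 simp: lipschitz_density_def\<close>)
  then show ?thesis
    using assms[THEN lipschitz_density_square_integrable]
    by (intro Quotient_rel_abs[OF Quotient_cube_L2]) (simp add: cube_L2_rel_def)
qed

lemma lipschitz_density_density_of:
  "P \<in> lipschitz_distributions \<Longrightarrow> lipschitz_density P (density_of P)"
  using someI_ex[of "lipschitz_density P"]
  by (simp add: density_of_def lipschitz_distributions_def)

lemma cube_measure_in_lipschitz_distributions:
  "(cube_measure :: (real^'d) measure) \<in> lipschitz_distributions"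
proof -
  have "lipschitz_density (cube_measure :: (real^'d) measure) (\<lambda>_. 1)"
    by (auto simp: lipschitz_density_def lipschitz_on_def density_1)
  then show ?thesis
    using cube_measure.prob_space_axioms by (auto simp: lipschitz_distributions_def)
qed


subsection \<open>Channels and risk\<close>

abbreviation sample_space :: "nat \<Rightarrow> (nat \<Rightarrow> real^'d) measure"
  where "sample_space n \<equiv> PiM {..<n} (\<lambda>_. restrict_space borel unit_cube)"

definition channels :: "nat \<Rightarrow> ((nat \<Rightarrow> real^'d) \<Rightarrow> 'd cube_L2 measure) set"
  where "channels n = measurable (sample_space n) (prob_algebra borel)"

definition differentially_private ::
    "nat \<Rightarrow> real \<Rightarrow> ((nat \<Rightarrow> real^'d) \<Rightarrow> 'd cube_L2 measure) \<Rightarrow> bool"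
  where "differentially_private n \<epsilon> Q \<longleftrightarrow>
    (\<forall>A\<in>sets borel. \<forall>x\<in>space (sample_space n). \<forall>x'\<in>space (sample_space n).
      card {i. i < n \<and> x i \<noteq> x' i} = 1 \<longrightarrow> measure (Q x) A \<le> exp \<epsilon> * measure (Q x') A)"

definition private_channels :: "nat \<Rightarrow> real \<Rightarrow> ((nat \<Rightarrow> real^'d) \<Rightarrow> 'd cube_L2 measure) set"
  where "private_channels n \<epsilon> = {Q \<in> channels n. differentially_private n \<epsilon> Q}"

definition risk ::
    "nat \<Rightarrow> ((nat \<Rightarrow> real^'d) \<Rightarrow> 'd cube_L2 measure) \<Rightarrow> (real^'d) measure \<Rightarrow> ennreal"
  where "risk n Q P =
    (\<integral>\<^sup>+x. (\<integral>\<^sup>+g. ennreal ((norm (g - to_cube_L2 (density_of P)))\<^sup>2) \<partial>Q x) \<partial>PiM {..<n} (\<lambda>_. P))"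

end

theory Submission
  imports Defs
begin

text \<open>Divide the cube into \<open>N = m\<^sup>d\<close> cells and add to the uniform density, independently for each cell,
  either nothing or an odd Lipschitz bump of scale \<open>1/m\<close>. The bumps are orthogonal in \<open>L\<^sup>2\<close>, with squared norm \<open>s\<close>
  of order \<open>m\<^bsup>-(d+2)\<^esup>\<close>, so by Bessel's inequality the loss is at least \<open>s/4\<close> times the
  number of cells in which the estimator guesses wrongly, and averaging over all subsets of cells
  (Assouad) reduces the bound to testing, cell by cell, between two densities that differ by one bump.
  If \<open>a\<close> and \<open>b\<close> are the probabilities of one event under the two alternatives, an inequality
  \<open>b\<^sup>2 \<le> B a\<close> bounds the testing error from below by \<open>1/(2B)\<close>. Two such inequalities are available:
  Cauchy--Schwarz gives \<open>B = (1 + 2s)\<^sup>n\<close> for every channel, while privacy gives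
  \<open>B = (1 + \<tau> (e\<^sup>\<epsilon> - 1))\<^sup>n\<close> with \<open>\<tau>\<close> the \<open>L\<^sup>1\<close> norm of a bump, of order \<open>m\<^bsup>-(d+1)\<^esup>\<close>. The largest \<open>m\<close> keeping
  \<open>B\<close> bounded is of order \<open>n\<^bsup>1/(d+2)\<^esup>\<close>, respectively \<open>(n\<epsilon>)\<^bsup>1/(d+1)\<^esup>\<close>, and the risk is of order \<open>1/m\<^sup>2\<close>.
  For \<open>\<epsilon> > 1\<close> the second rate is dominated by the first.\<close>

subsection \<open>Change of measure for product distributions\<close>

lemma product_sigma_finite_const:
  "prob_space M \<Longrightarrow> product_sigma_finite (\<lambda>_. M)"
  by (simp add: product_sigma_finite_def prob_space_imp_sigma_finite)

lemma measurable_PiM_fun_upd_const: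
  assumes "p \<in> borel_measurable (PiM (insert i I) (\<lambda>_. M))" "y \<in> space M"
  shows "(\<lambda>x. p (x(i := y))) \<in> borel_measurable (PiM I (\<lambda>_. M))"
  using assms(1)
proof (rule measurable_compose[rotated])
  show "(\<lambda>x. x(i := y)) \<in> PiM I (\<lambda>_. M) \<rightarrow>\<^sub>M PiM (insert i I) (\<lambda>_. M)"
    using assms(2) by (intro measurable_fun_upd[where J=I]) auto
qed

lemma nn_integral_PiM_fun_upd_measurable:
  assumes "prob_space M"
  assumes p: "p \<in> borel_measurable (PiM (insert i I) (\<lambda>_. M))"
  assumes "finite I"
  shows "(\<lambda>y. \<integral>\<^sup>+x. p (x(i := y)) \<partial>PiM I (\<lambda>_. M)) \<in> borel_measurable M"
proof -
  interpret prob_space M by fact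
  interpret P: prob_space "PiM I (\<lambda>_. M)"
    using assms(1) by (intro prob_space_PiM)
  have "(\<lambda>z. p ((snd z)(i := fst z))) \<in> borel_measurable (M \<Otimes>\<^sub>M PiM I (\<lambda>_. M))"
    using p by measurable
  then show ?thesis
    by (intro P.borel_measurable_nn_integral) (simp add: case_prod_unfold)
qed

text \<open>Induction on the coordinates. The one-observation inequality \<open>step\<close> is
  applied in coordinate \<open>i\<close> to \<open>p\<close> with the other coordinates averaged
  under \<open>N\<close>; for each fixed value of coordinate \<open>i\<close> the induction
  hypothesis then passes from \<open>N\<close> to \<open>M\<close> in the rest. Each coordinate
  costs one factor \<open>B\<close>.\<close>

lemma nn_integral_PiM_square_le:
  assumes M: "prob_space M" and N: "prob_space N" and sets: "sets N = sets M"
    and step: "\<And>q. q \<in> borel_measurable M \<Longrightarrow> (\<integral>\<^sup>+y. q y \<partial>N)\<^sup>2 \<le> B * (\<integral>\<^sup>+y. (q y)\<^sup>2 \<partial>M)"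
    and "finite I" and "p \<in> borel_measurable (PiM I (\<lambda>_. M))"
  shows "(\<integral>\<^sup>+x. p x \<partial>PiM I (\<lambda>_. N))\<^sup>2 \<le> B ^ card I * (\<integral>\<^sup>+x. (p x)\<^sup>2 \<partial>PiM I (\<lambda>_. M))"
  using \<open>finite I\<close> \<open>p \<in> _\<close>
proof (induction I arbitrary: p rule: finite_induct)
  case empty
  then show ?case
    by (simp add: PiM_empty nn_integral_count_space_finite)
next
  case (insert i I)
  interpret M: product_sigma_finite "\<lambda>_. M" using M by (rule product_sigma_finite_const)
  interpret N: product_sigma_finite "\<lambda>_. N" using N by (rule product_sigma_finite_const)
  have setsI: "sets (PiM J (\<lambda>_. N)) = sets (PiM J (\<lambda>_. M))" for J
    using sets by (intro sets_PiM_cong) auto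
  have pN: "p \<in> borel_measurable (PiM (insert i I) (\<lambda>_. N))"
    using insert.prems by (simp add: measurable_cong_sets[OF setsI refl])
  have p2: "(\<lambda>x. (p x)\<^sup>2) \<in> borel_measurable (PiM (insert i I) (\<lambda>_. M))"
    using insert.prems by simp
  let ?G = "\<lambda>y. \<integral>\<^sup>+x. p (x(i := y)) \<partial>PiM I (\<lambda>_. N)"
  have "?G \<in> borel_measurable N"
    using N pN insert.hyps(1) by (rule nn_integral_PiM_fun_upd_measurable)
  then have G: "?G \<in> borel_measurable M"
    by (simp add: measurable_cong_sets[OF sets refl])
  have H: "(\<lambda>y. \<integral>\<^sup>+x. (p (x(i := y)))\<^sup>2 \<partial>PiM I (\<lambda>_. M)) \<in> borel_measurable M"
    using M p2 insert.hyps(1) by (rule nn_integral_PiM_fun_upd_measurable)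
  have "(\<integral>\<^sup>+x. p x \<partial>PiM (insert i I) (\<lambda>_. N))\<^sup>2 = (\<integral>\<^sup>+y. ?G y \<partial>N)\<^sup>2"
    using insert.hyps pN by (simp add: N.product_nn_integral_insert_rev)
  also have "\<dots> \<le> B * (\<integral>\<^sup>+y. (?G y)\<^sup>2 \<partial>M)"
    using G by (rule step)
  also have "\<dots> \<le> B * (\<integral>\<^sup>+y. B ^ card I * (\<integral>\<^sup>+x. (p (x(i := y)))\<^sup>2 \<partial>PiM I (\<lambda>_. M)) \<partial>M)"
    by (intro mult_left_mono nn_integral_mono insert.IH measurable_PiM_fun_upd_const[OF insert.prems]) auto
  also have "\<dots> = B ^ card (insert i I) *
      (\<integral>\<^sup>+y. (\<integral>\<^sup>+x. (p (x(i := y)))\<^sup>2 \<partial>PiM I (\<lambda>_. M)) \<partial>M)"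
    using H insert.hyps by (simp add: nn_integral_cmult mult.assoc)
  also have "(\<integral>\<^sup>+y. (\<integral>\<^sup>+x. (p (x(i := y)))\<^sup>2 \<partial>PiM I (\<lambda>_. M)) \<partial>M)
      = (\<integral>\<^sup>+x. (p x)\<^sup>2 \<partial>PiM (insert i I) (\<lambda>_. M))"
    using insert.hyps p2 by (simp add: M.product_nn_integral_insert_rev)
  finally show ?case .
qed

text \<open>The same induction, except that \<open>step\<close> is available only for functions
  whose values stay within a factor \<open>L\<close> of each other. This ratio bound has to survive
  both averaging over the other coordinates and freezing coordinate \<open>i\<close>.\<close>

lemma nn_integral_PiM_le_of_insensitive:
  assumes M: "prob_space M" and N: "prob_space N" and sets: "sets N = sets M"
    and step: "\<And>q. q \<in> borel_measurable M \<Longrightarrow>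
        (\<And>y y'. y \<in> space M \<Longrightarrow> y' \<in> space M \<Longrightarrow> q y \<le> L * q y') \<Longrightarrow>
        (\<integral>\<^sup>+y. q y \<partial>N) \<le> B * (\<integral>\<^sup>+y. q y \<partial>M)"
    and "finite I" and "p \<in> borel_measurable (PiM I (\<lambda>_. M))"
    and "\<And>x i y. x \<in> space (PiM I (\<lambda>_. M)) \<Longrightarrow> i \<in> I \<Longrightarrow> y \<in> space M \<Longrightarrow>
        p x \<le> L * p (x(i := y))"
  shows "(\<integral>\<^sup>+x. p x \<partial>PiM I (\<lambda>_. N)) \<le> B ^ card I * (\<integral>\<^sup>+x. p x \<partial>PiM I (\<lambda>_. M))"
  using assms(5-7)
proof (induction I arbitrary: p rule: finite_induct)
  case empty
  then show ?case
    by (simp add: PiM_empty nn_integral_count_space_finite)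
next
  case (insert i I)
  note prems = insert.prems
  interpret M: product_sigma_finite "\<lambda>_. M" using M by (rule product_sigma_finite_const)
  interpret N: product_sigma_finite "\<lambda>_. N" using N by (rule product_sigma_finite_const)
  have space: "space N = space M" using sets by (rule sets_eq_imp_space_eq)
  have setsI: "sets (PiM J (\<lambda>_. N)) = sets (PiM J (\<lambda>_. M))" for J
    using sets by (intro sets_PiM_cong) auto
  have pN: "p \<in> borel_measurable (PiM (insert i I) (\<lambda>_. N))"
    using prems(1) by (simp add: measurable_cong_sets[OF setsI refl])
  have upd: "x(i := y) \<in> space (PiM (insert i I) (\<lambda>_. M))"
    if "x \<in> space (PiM I (\<lambda>_. M))" "y \<in> space M" for x y
    using that by (auto simp: space_PiM PiE_iff extensional_def)
  let ?G = "\<lambda>y. \<integral>\<^sup>+x. p (x(i := y)) \<partial>PiM I (\<lambda>_. N)"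
  have "?G \<in> borel_measurable N"
    using N pN insert.hyps(1) by (rule nn_integral_PiM_fun_upd_measurable)
  then have G: "?G \<in> borel_measurable M"
    by (simp add: measurable_cong_sets[OF sets refl])
  have H: "(\<lambda>y. \<integral>\<^sup>+x. p (x(i := y)) \<partial>PiM I (\<lambda>_. M)) \<in> borel_measurable M"
    using M prems(1) insert.hyps(1) by (rule nn_integral_PiM_fun_upd_measurable)
  \<comment> \<open>The ratio bound holds pointwise in the remaining coordinates, so it can be
    integrated.\<close>
  have GL: "?G y \<le> L * ?G y'" if y: "y \<in> space M" "y' \<in> space M" for y y'
  proof -
    have "?G y \<le> (\<integral>\<^sup>+x. L * p (x(i := y')) \<partial>PiM I (\<lambda>_. N))"
    proof (rule nn_integral_mono)
      fix x assume "x \<in> space (PiM I (\<lambda>_. N))"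
      then have x: "x \<in> space (PiM I (\<lambda>_. M))"
        using sets_eq_imp_space_eq[OF setsI] by blast
      show "p (x(i := y)) \<le> L * p (x(i := y'))"
        using prems(2)[OF upd[OF x y(1)] insertI1 y(2)] by (simp only: fun_upd_upd)
    qed
    also have "\<dots> = L * ?G y'"
      using measurable_PiM_fun_upd_const[OF pN, of y'] y(2) space by (intro nn_integral_cmult) auto
    finally show ?thesis .
  qed
  have "(\<integral>\<^sup>+x. p x \<partial>PiM (insert i I) (\<lambda>_. N)) = (\<integral>\<^sup>+y. ?G y \<partial>N)"
    using insert.hyps pN by (simp add: N.product_nn_integral_insert_rev)
  also have "\<dots> \<le> B * (\<integral>\<^sup>+y. ?G y \<partial>M)"
    using G GL by (rule step)
  also have "\<dots> \<le> B * (\<integral>\<^sup>+y. B ^ card I * (\<integral>\<^sup>+x. p (x(i := y)) \<partial>PiM I (\<lambda>_. M)) \<partial>M)"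
  proof (intro mult_left_mono nn_integral_mono)
    fix y assume y: "y \<in> space M"
    show "?G y \<le> B ^ card I * (\<integral>\<^sup>+x. p (x(i := y)) \<partial>PiM I (\<lambda>_. M))"
    proof (rule insert.IH)
      show "(\<lambda>x. p (x(i := y))) \<in> borel_measurable (PiM I (\<lambda>_. M))"
        using prems(1) y by (rule measurable_PiM_fun_upd_const)
      fix x j y' assume x: "x \<in> space (PiM I (\<lambda>_. M))" and j: "j \<in> I" and y': "y' \<in> space M"
      then have "x(j := y', i := y) = x(i := y, j := y')"
        using insert.hyps by (intro fun_upd_twist) auto
      then show "p (x(i := y)) \<le> L * p (x(j := y', i := y))"
        using prems(2)[OF upd[OF x y] insertI2[OF j] y'] by (simp only:)
    qed
  qed auto
  also have "\<dots> = B ^ card (insert i I) * (\<integral>\<^sup>+y. (\<integral>\<^sup>+x. p (x(i := y)) \<partial>PiM I (\<lambda>_. M)) \<partial>M)"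
    using H insert.hyps by (simp add: nn_integral_cmult mult.assoc)
  also have "(\<integral>\<^sup>+y. (\<integral>\<^sup>+x. p (x(i := y)) \<partial>PiM I (\<lambda>_. M)) \<partial>M)
      = (\<integral>\<^sup>+x. p x \<partial>PiM (insert i I) (\<lambda>_. M))"
    using insert.hyps prems(1) by (simp add: M.product_nn_integral_insert_rev)
  finally show ?case .
qed

text \<open>Cauchy-Schwarz for \<open>g * q\<close> factored as \<open>g / sqrt f\<close> times
  \<open>sqrt f * q\<close>. For probability densities the quantity bounded by \<open>B\<close> is
  one plus the chi-square divergence of \<open>g\<close> from \<open>f\<close>.\<close>

lemma nn_integral_density_square_le:
  assumes f: "f \<in> borel_measurable M" "\<And>t. t \<in> space M \<Longrightarrow> 0 < f t"
    and g: "g \<in> borel_measurable M" "\<And>t. t \<in> space M \<Longrightarrow> 0 \<le> g t"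
    and B: "(\<integral>\<^sup>+t. ennreal ((g t)\<^sup>2 / f t) \<partial>M) \<le> B"
    and q: "q \<in> borel_measurable M"
  shows "(\<integral>\<^sup>+t. q t \<partial>density M (\<lambda>t. ennreal (g t)))\<^sup>2
    \<le> B * (\<integral>\<^sup>+t. (q t)\<^sup>2 \<partial>density M (\<lambda>t. ennreal (f t)))"
proof -
  note [measurable] = f(1) g(1) q
  have *: "ennreal (g t) * q t = ennreal (g t / sqrt (f t)) * (ennreal (sqrt (f t)) * q t)"
    if "t \<in> space M" for t
    using f(2)[OF that] g(2)[OF that]
    by (simp add: mult.assoc[symmetric] ennreal_mult[symmetric] del: ennreal_mult)
  have "(\<integral>\<^sup>+t. q t \<partial>density M (\<lambda>t. ennreal (g t)))\<^sup>2
      = (\<integral>\<^sup>+t. ennreal (g t / sqrt (f t)) * (ennreal (sqrt (f t)) * q t) \<partial>M)\<^sup>2"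
    by (simp add: nn_integral_density * cong: nn_integral_cong)
  also have "\<dots> \<le> (\<integral>\<^sup>+t. (ennreal (g t / sqrt (f t)))\<^sup>2 \<partial>M) * (\<integral>\<^sup>+t. (ennreal (sqrt (f t)) * q t)\<^sup>2 \<partial>M)"
    by (rule Cauchy_Schwarz_nn_integral) auto
  also have "(\<integral>\<^sup>+t. (ennreal (g t / sqrt (f t)))\<^sup>2 \<partial>M) = (\<integral>\<^sup>+t. ennreal ((g t)\<^sup>2 / f t) \<partial>M)"
    using f(2) g(2) by (intro nn_integral_cong) (simp add: ennreal_power power_divide less_imp_le)
  also have "(\<integral>\<^sup>+t. (ennreal (sqrt (f t)) * q t)\<^sup>2 \<partial>M) = (\<integral>\<^sup>+t. (q t)\<^sup>2 \<partial>density M (\<lambda>t. ennreal (f t)))"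
    by (subst nn_integral_density)
      (use f(2) in \<open>auto intro!: nn_integral_cong simp: power_mult_distrib ennreal_power less_imp_le\<close>)
  also have "(\<integral>\<^sup>+t. ennreal ((g t)\<^sup>2 / f t) \<partial>M) * (\<integral>\<^sup>+t. (q t)\<^sup>2 \<partial>density M (\<lambda>t. ennreal (f t)))
      \<le> B * (\<integral>\<^sup>+t. (q t)\<^sup>2 \<partial>density M (\<lambda>t. ennreal (f t)))"
    using B by (rule mult_right_mono) simp
  finally show ?thesis .
qed

text \<open>The masses of \<open>(g - f)\<^sup>+\<close> and \<open>(f - g)\<^sup>+\<close> agree, and \<open>q\<close> varies by at most
  \<open>K inf q\<close> when one is transported onto the other.\<close>

lemma nn_integral_density_le_of_insensitive:
  assumes f: "f \<in> borel_measurable M" "\<And>t. t \<in> space M \<Longrightarrow> 0 \<le> f t"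
    and g: "g \<in> borel_measurable M" "\<And>t. t \<in> space M \<Longrightarrow> 0 \<le> g t"
    and prob: "prob_space (density M (\<lambda>t. ennreal (f t)))"
    and \<delta>: "(\<integral>\<^sup>+t. ennreal (g t - f t) \<partial>M) \<le> \<delta>"
      "(\<integral>\<^sup>+t. ennreal (g t - f t) \<partial>M) = (\<integral>\<^sup>+t. ennreal (f t - g t) \<partial>M)"
    and K: "K \<noteq> \<top>" and q: "q \<in> borel_measurable M"
      "\<And>t t'. t \<in> space M \<Longrightarrow> t' \<in> space M \<Longrightarrow> q t \<le> (1 + K) * q t'"
  shows "(\<integral>\<^sup>+t. q t \<partial>density M (\<lambda>t. ennreal (g t)))
    \<le> (1 + \<delta> * K) * (\<integral>\<^sup>+t. q t \<partial>density M (\<lambda>t. ennreal (f t)))"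
proof -
  note [measurable] = f(1) g(1) q(1)
  define S where "S = (SUP t\<in>space M. q t)"
  \<comment> \<open>By the ratio bound \<open>l\<close> lies below all values of \<open>q\<close>,
    while \<open>S = l + K * l\<close> lies above them; so \<open>l\<close> stands in for the
    infimum.\<close>
  define l where "l = S / (1 + K)"
  define D where "D = (\<integral>\<^sup>+t. ennreal (g t - f t) \<partial>M)"
  let ?f = "\<integral>\<^sup>+t. q t \<partial>density M (\<lambda>t. ennreal (f t))"
  have K': "1 + K \<noteq> 0" "1 + K \<noteq> \<top>"
    using K by auto
  have l_le: "l \<le> q t" if "t \<in> space M" for t
    unfolding l_def S_def using K' that q(2)
    by (intro divide_le_posI_ennreal SUP_least) (auto simp: zero_less_iff_neq_zero mult.commute)
  have q_le: "q t \<le> l + K * l" if "t \<in> space M" for t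
  proof -
    have "q t \<le> S"
      unfolding S_def using that by (rule SUP_upper)
    also have "S = (1 + K) * l"
      unfolding l_def using K'
      by (simp add: ennreal_times_divide mult.commute[of "1 + K"] ennreal_mult_divide_eq)
    finally show ?thesis by (simp add: algebra_simps)
  qed
  have fint: "(\<integral>\<^sup>+t. ennreal (f t) \<partial>M) = 1"
    using prob_space.emeasure_space_1[OF prob] f(1) by (simp add: emeasure_density cong: nn_integral_cong_simp)
  have l_int: "l \<le> ?f"
  proof -
    have "l = (\<integral>\<^sup>+t. ennreal (f t) * l \<partial>M)"
      using fint by (simp add: nn_integral_multc)
    also have "\<dots> \<le> (\<integral>\<^sup>+t. ennreal (f t) * q t \<partial>M)"
      by (intro nn_integral_mono mult_left_mono l_le) auto
    finally show ?thesis by (simp add: nn_integral_density)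
  qed
  \<comment> \<open>A density is the mass shared with the other one plus its excess;
    \<open>ennreal\<close> turns a negative difference into 0.\<close>
  have split: "ennreal (a t) = ennreal (min (a t) (b t)) + ennreal (a t - b t)"
    if "0 \<le> a t" "0 \<le> b t" for a b :: "_ \<Rightarrow> real" and t
  proof (cases "a t \<le> b t")
    case False
    then show ?thesis using that by (simp add: min_def ennreal_plus[symmetric] del: ennreal_plus)
  qed (simp add: min_def ennreal_neg)
  have "(\<integral>\<^sup>+t. q t \<partial>density M (\<lambda>t. ennreal (g t)))
      = (\<integral>\<^sup>+t. ennreal (min (g t) (f t)) * q t + ennreal (g t - f t) * q t \<partial>M)"
    using f(2) g(2)
    by (auto simp: nn_integral_density split[of g _ f] distrib_right intro!: nn_integral_cong)
  also have "\<dots> = (\<integral>\<^sup>+t. ennreal (min (g t) (f t)) * q t \<partial>M) + (\<integral>\<^sup>+t. ennreal (g t - f t) * q t \<partial>M)"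
    by (rule nn_integral_add) auto
  also have "(\<integral>\<^sup>+t. ennreal (g t - f t) * q t \<partial>M) \<le> (\<integral>\<^sup>+t. ennreal (g t - f t) * (l + K * l) \<partial>M)"
    by (intro nn_integral_mono mult_left_mono q_le) auto
  also have "\<dots> = D * l + D * (K * l)"
    unfolding D_def by (subst nn_integral_multc) (auto simp: distrib_left)
  \<comment> \<open>Since the two excess masses agree, \<open>D * l\<close> can be charged to the
    region where \<open>f\<close> exceeds \<open>g\<close>, where again \<open>q\<close> is at least
    \<open>l\<close>. Only \<open>D * (K * l)\<close> remains as extra cost.\<close>
  also have "D * l = (\<integral>\<^sup>+t. ennreal (f t - g t) * l \<partial>M)"
    by (simp add: nn_integral_multc D_def \<delta>(2))
  also have "\<dots> \<le> (\<integral>\<^sup>+t. ennreal (f t - g t) * q t \<partial>M)"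
    by (intro nn_integral_mono mult_left_mono l_le) auto
  also have "(\<integral>\<^sup>+t. ennreal (min (g t) (f t)) * q t \<partial>M) +
        ((\<integral>\<^sup>+t. ennreal (f t - g t) * q t \<partial>M) + D * (K * l))
      = (\<integral>\<^sup>+t. ennreal (min (f t) (g t)) * q t + ennreal (f t - g t) * q t \<partial>M) + D * (K * l)"
    by (subst nn_integral_add) (auto simp: min.commute add.assoc)
  also have "(\<integral>\<^sup>+t. ennreal (min (f t) (g t)) * q t + ennreal (f t - g t) * q t \<partial>M) = ?f"
    using f(2) g(2)
    by (auto simp: nn_integral_density split[of f _ g] distrib_right intro!: nn_integral_cong)
  also have "?f + D * (K * l) \<le> ?f + \<delta> * (K * ?f)"
    using \<delta>(1) l_int unfolding D_def by (intro add_left_mono mult_mono) auto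
  finally show ?thesis
    by (simp add: algebra_simps add_left_mono)
qed

subsection \<open>Assouad's method\<close>

lemma sum_Pow_split:
  fixes f :: "'a set \<Rightarrow> real"
  assumes "finite C" "j \<in> C"
  shows "(\<Sum>v\<in>Pow C. f v) = (\<Sum>v\<in>Pow (C - {j}). f v + f (insert j v))"
proof -
  have C: "Pow C = Pow (C - {j}) \<union> insert j ` Pow (C - {j})"
    using assms(2) by (metis Pow_insert insert_Diff)
  have inj: "inj_on (insert j) (Pow (C - {j}))"
    by (rule inj_onI) (metis Diff_insert_absorb PowD Set.set_insert subset_Diff_insert)
  show ?thesis
    unfolding C using assms(1)
    by (subst sum.union_disjoint) (auto simp: sum.distrib sum.reindex[OF inj])
qed

text \<open>If every subset fell short, so would the sum over \<open>Pow C\<close>. But for fixed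
  \<open>j\<close> the subsets form pairs \<open>v\<close>, \<open>insert j v\<close>, half as many
  as there are subsets, and each pair contributes at least \<open>\<tau>\<close>. This is where the
  factor 1/2 comes from.\<close>

lemma hypercube_average:
  fixes t :: "'a set \<Rightarrow> 'a \<Rightarrow> real"
  assumes C: "finite C"
    and t: "\<And>v j. j \<in> C \<Longrightarrow> v \<subseteq> C - {j} \<Longrightarrow> \<tau> \<le> t v j + t (insert j v) j"
  shows "\<exists>v\<subseteq>C. real (card C) * \<tau> / 2 \<le> (\<Sum>j\<in>C. t v j)"
proof (rule ccontr)
  assume "\<not> ?thesis"
  then have *: "(\<Sum>j\<in>C. t v j) < real (card C) * \<tau> / 2" if "v \<in> Pow C" for v
    using that by (meson PowD not_less)
  have "(\<Sum>v\<in>Pow C. \<Sum>j\<in>C. t v j) < (\<Sum>v\<in>Pow C. real (card C) * \<tau> / 2)"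
    using C * by (intro sum_strict_mono) auto
  also have "\<dots> = (\<Sum>j\<in>C. 2 ^ card C * \<tau> / 2)"
    using C by (simp add: card_Pow)
  also have "\<dots> \<le> (\<Sum>j\<in>C. \<Sum>v\<in>Pow C. t v j)"
  proof (rule sum_mono)
    fix j assume j: "j \<in> C"
    have "(2::real) ^ card C = 2 * 2 ^ card (C - {j})"
      using C j by (metis card_Suc_Diff1 power_Suc)
    then have "2 ^ card C * \<tau> / 2 = (\<Sum>v\<in>Pow (C - {j}). \<tau>)"
      using C by (simp add: card_Pow)
    also have "\<dots> \<le> (\<Sum>v\<in>Pow (C - {j}). t v j + t (insert j v) j)"
      using j t by (intro sum_mono) auto
    finally show "2 ^ card C * \<tau> / 2 \<le> (\<Sum>v\<in>Pow C. t v j)"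
      by (simp only: sum_Pow_split[OF C j])
  qed
  also have "\<dots> = (\<Sum>v\<in>Pow C. \<Sum>j\<in>C. t v j)"
    by (rule sum.swap)
  finally show False by simp
qed

text \<open>Starts from \<open>1/2 \<le> b^2 + (1 - b)^2\<close> and bounds both terms by multiples
  of \<open>B\<close>. In use, \<open>a\<close> is the false alarm probability of a test and
  \<open>b\<close> its power. The squared hypothesis serves the Cauchy-Schwarz bound and the privacy
  bound alike.\<close>

lemma testing_error_ge:
  fixes a b B :: real
  assumes "b\<^sup>2 \<le> B * a" "1 \<le> B" "0 \<le> b" "b \<le> 1"
  shows "1 / (2 * B) \<le> a + (1 - b)"
proof -
  have "1 / 2 \<le> b\<^sup>2 + (1 - b)\<^sup>2"
    using sum_squares_ge_zero[of "b - 1/2" 0] by (simp add: power2_eq_square algebra_simps)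
  also have "(1 - b)\<^sup>2 \<le> 1 * (1 - b)"
    unfolding power2_eq_square using assms by (intro mult_right_mono) auto
  also have "1 * (1 - b) \<le> B * (1 - b)"
    using assms by (intro mult_right_mono) auto
  finally have "1 / 2 \<le> B * (a + (1 - b))"
    using assms(1) by (simp add: distrib_left)
  then show ?thesis
    using assms(2) by (simp add: field_simps)
qed

text \<open>The vector \<open>y\<close> is the orthogonal projection of \<open>x\<close> onto the
  span of the \<open>u j\<close>, and the squared norm of \<open>x - y\<close> is nonnegative. A
  common squared norm \<open>s\<close> is allowed so that bumps need not be normalised.\<close>

lemma Bessel_inequality:
  fixes x :: "'a :: real_inner"
  assumes J: "finite J" and "0 < s"
    and u: "\<And>i j. i \<in> J \<Longrightarrow> j \<in> J \<Longrightarrow> inner (u i) (u j) = (if i = j then s else 0)"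
  shows "(\<Sum>j\<in>J. (inner x (u j))\<^sup>2 / s) \<le> (norm x)\<^sup>2"
proof -
  define y where "y = (\<Sum>j\<in>J. (inner x (u j) / s) *\<^sub>R u j)"
  have yu: "inner y (u j) = inner x (u j)" if "j \<in> J" for j
    using that J \<open>0 < s\<close>
    by (simp add: y_def inner_sum_left u if_distrib[of "\<lambda>z. _ * z"] cong: if_cong)
  have xy: "inner x y = (\<Sum>j\<in>J. (inner x (u j))\<^sup>2 / s)"
    by (simp add: y_def inner_sum_right power2_eq_square)
  have "inner y y = (\<Sum>j\<in>J. inner x (u j) / s * inner y (u j))"
    by (subst (2) y_def) (simp add: inner_sum_right)
  then have yy: "inner y y = (\<Sum>j\<in>J. (inner x (u j))\<^sup>2 / s)"
    by (simp add: yu power2_eq_square)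
  have "0 \<le> inner (x - y) (x - y)" by simp
  also have "\<dots> = inner x x - 2 * inner x y + inner y y"
    by (simp add: inner_diff_left inner_diff_right inner_commute)
  finally show ?thesis
    by (simp add: xy yy power2_norm_eq_inner)
qed

section \<open>The law of the estimate under a channel\<close>

definition output_prob ::
    "nat \<Rightarrow> ((nat \<Rightarrow> real^'d) \<Rightarrow> 'd cube_L2 measure) \<Rightarrow> (real^'d) measure \<Rightarrow> 'd cube_L2 set \<Rightarrow> real"
  where "output_prob n Q P A = (\<integral>x. measure (Q x) A \<partial>PiM {..<n} (\<lambda>_. P))"

lemma sets_restrict_borel_cube: "sets (restrict_space borel unit_cube) = sets cube_measure"
  unfolding cube_measure_def by (intro sets_restrict_space_cong) simp

lemma sets_PiM_sample_space:
  "sets P = sets cube_measure \<Longrightarrow> sets (PiM I (\<lambda>_. P)) = sets (PiM I (\<lambda>_. restrict_space borel unit_cube))"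
  by (intro sets_PiM_cong) (auto simp: sets_restrict_borel_cube)

lemma channelsD:
  assumes "Q \<in> channels n" "x \<in> space (sample_space n)"
  shows "prob_space (Q x)" "sets (Q x) = sets borel"
  using measurable_space[OF assms(1)[unfolded channels_def] assms(2)]
  by (simp_all add: space_prob_algebra)

lemma measurable_channel_measure:
  assumes "Q \<in> channels n" "A \<in> sets borel" "sets P = sets cube_measure"
  shows "(\<lambda>x. measure (Q x) A) \<in> borel_measurable (PiM {..<n} (\<lambda>_. P))"
  using measurable_compose[OF assms(1)[unfolded channels_def] measurable_measure_prob_algebra[OF assms(2)]]
  by (simp add: measurable_cong_sets[OF sets_PiM_sample_space[OF assms(3)] refl])

context
  fixes Q :: "(nat \<Rightarrow> real^'d) \<Rightarrow> 'd cube_L2 measure" and n and P :: "(real^'d) measure"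
  assumes Q: "Q \<in> channels n" and P: "prob_space P" "sets P = sets cube_measure"
begin

interpretation PP: prob_space "PiM {..<n} (\<lambda>_. P)"
  using P(1) by (intro prob_space_PiM)

private lemma space_PP: "x \<in> space (PiM {..<n} (\<lambda>_. P)) \<Longrightarrow> x \<in> space (sample_space n)"
  using sets_eq_imp_space_eq[OF sets_PiM_sample_space[OF P(2)]] by blast

private lemma integrable_output:
  assumes "A \<in> sets borel"
  shows "integrable (PiM {..<n} (\<lambda>_. P)) (\<lambda>x. measure (Q x) A)"
  using measurable_channel_measure[OF Q assms P(2)]
  by (intro PP.integrable_const_bound[where B=1])
    (auto intro!: AE_I2 prob_space.prob_le_1 channelsD(1)[OF Q] space_PP)

lemma output_prob_nonneg: "0 \<le> output_prob n Q P A"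
  unfolding output_prob_def by simp

lemma output_prob_le_1:
  assumes "A \<in> sets borel"
  shows "output_prob n Q P A \<le> 1"
proof -
  have "output_prob n Q P A \<le> (\<integral>x. 1 \<partial>PiM {..<n} (\<lambda>_. P))"
    unfolding output_prob_def using integrable_output[OF assms]
    by (intro integral_mono) (auto intro!: prob_space.prob_le_1 channelsD(1)[OF Q] space_PP)
  then show ?thesis by (simp add: PP.prob_space)
qed

lemma output_prob_Compl:
  assumes "A \<in> sets borel"
  shows "output_prob n Q P (- A) = 1 - output_prob n Q P A"
proof -
  have "measure (Q x) (- A) = 1 - measure (Q x) A" if "x \<in> space (PiM {..<n} (\<lambda>_. P))" for x
  proof -
    note Qx = channelsD[OF Q space_PP[OF that]]
    interpret prob_space "Q x" by (rule Qx)
    have "space (Q x) = UNIV" using sets_eq_imp_space_eq[OF Qx(2)] by simp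
    then show ?thesis
      using prob_compl[of A] assms Qx(2) by (simp add: Compl_eq_Diff_UNIV)
  qed
  then have "output_prob n Q P (- A) = (\<integral>x. 1 - measure (Q x) A \<partial>PiM {..<n} (\<lambda>_. P))"
    unfolding output_prob_def by (intro Bochner_Integration.integral_cong) auto
  also have "\<dots> = 1 - output_prob n Q P A"
    unfolding output_prob_def using integrable_output[OF assms]
    by (subst Bochner_Integration.integral_diff) (auto simp: PP.prob_space)
  finally show ?thesis .
qed

lemma nn_integral_output_prob:
  assumes "A \<in> sets borel"
  shows "(\<integral>\<^sup>+x. ennreal (measure (Q x) A) \<partial>PiM {..<n} (\<lambda>_. P)) = ennreal (output_prob n Q P A)"
  unfolding output_prob_def using integrable_output[OF assms] by (intro nn_integral_eq_integral) auto

text \<open>Connects risk with testing: a pointwise lower bound of the loss by weighted indicators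
  is integrated first over the channel, then over the sample.\<close>

lemma risk_ge_output_prob:
  assumes f: "lipschitz_density P f" and J: "finite J" and "0 \<le> a"
    and E: "\<And>j. j \<in> J \<Longrightarrow> E j \<in> sets borel"
    and loss: "\<And>g. (\<Sum>j\<in>J. a * indicator (E j) g) \<le> (norm (g - to_cube_L2 f))\<^sup>2"
  shows "ennreal (\<Sum>j\<in>J. a * output_prob n Q P (E j)) \<le> risk n Q P"
proof -
  have "P \<in> lipschitz_distributions"
    using f P(1) by (auto simp: lipschitz_distributions_def)
  then have dens: "to_cube_L2 (density_of P) = to_cube_L2 f"
    using f lipschitz_density_unique lipschitz_density_density_of by blast
  have inner: "ennreal (\<Sum>j\<in>J. a * measure (Q x) (E j))
      \<le> (\<integral>\<^sup>+g. ennreal ((norm (g - to_cube_L2 f))\<^sup>2) \<partial>Q x)"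
    if "x \<in> space (PiM {..<n} (\<lambda>_. P))" for x
  proof -
    note Qx = channelsD[OF Q space_PP[OF that]]
    interpret prob_space "Q x" by (rule Qx)
    have int: "integrable (Q x) (\<lambda>g. a * indicator (E j) g)" if "j \<in> J" for j
      using that E Qx(2) by (intro integrable_mult_right integrable_real_indicator) (auto simp: less_top[symmetric])
    have "ennreal (\<Sum>j\<in>J. a * measure (Q x) (E j)) = ennreal (\<integral>g. (\<Sum>j\<in>J. a * indicator (E j) g) \<partial>Q x)"
      using int sets_eq_imp_space_eq[OF Qx(2)] by (subst Bochner_Integration.integral_sum) auto
    also have "\<dots> = (\<integral>\<^sup>+g. ennreal (\<Sum>j\<in>J. a * indicator (E j) g) \<partial>Q x)"
      using int \<open>0 \<le> a\<close>
      by (intro nn_integral_eq_integral[symmetric] Bochner_Integration.integrable_sum)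
        (auto intro!: AE_I2 sum_nonneg)
    also have "\<dots> \<le> (\<integral>\<^sup>+g. ennreal ((norm (g - to_cube_L2 f))\<^sup>2) \<partial>Q x)"
      by (intro nn_integral_mono ennreal_leI loss)
    finally show ?thesis .
  qed
  have "ennreal (\<Sum>j\<in>J. a * output_prob n Q P (E j))
      = ennreal (\<integral>x. (\<Sum>j\<in>J. a * measure (Q x) (E j)) \<partial>PiM {..<n} (\<lambda>_. P))"
    unfolding output_prob_def using E integrable_output
    by (subst Bochner_Integration.integral_sum) auto
  also have "\<dots> = (\<integral>\<^sup>+x. ennreal (\<Sum>j\<in>J. a * measure (Q x) (E j)) \<partial>PiM {..<n} (\<lambda>_. P))"
    using E integrable_output \<open>0 \<le> a\<close>
    by (intro nn_integral_eq_integral[symmetric] Bochner_Integration.integrable_sum)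
      (auto intro!: AE_I2 sum_nonneg)
  also have "\<dots> \<le> risk n Q P"
    unfolding risk_def dens by (intro nn_integral_mono inner)
  finally show ?thesis .
qed

end

text \<open>Any estimate is converted into a guess of \<open>v\<close> by thresholding its
  coefficients along the \<open>u j\<close>. By Bessel each wrong guess costs at least
  \<open>s / 4\<close>, and \<open>test\<close> prevents the guesses from being reliable for all
  \<open>v\<close>.\<close>

lemma assouad_risk_ge:
  fixes f :: "'a set \<Rightarrow> real^'d \<Rightarrow> real" and u :: "'a \<Rightarrow> 'd cube_L2"
  assumes Q: "Q \<in> channels n" and C: "finite C" and s: "0 < s" and B: "1 \<le> B"
    and P: "\<And>v. v \<subseteq> C \<Longrightarrow> prob_space (P v)"
    and f: "\<And>v. v \<subseteq> C \<Longrightarrow> lipschitz_density (P v) (f v)"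
    and orth: "\<And>i j. i \<in> C \<Longrightarrow> j \<in> C \<Longrightarrow> inner (u i) (u j) = (if i = j then s else 0)"
    and sep: "\<And>v j. v \<subseteq> C \<Longrightarrow> j \<in> C \<Longrightarrow> inner (to_cube_L2 (f v)) (u j) = (if j \<in> v then s else 0)"
    and test: "\<And>v j A. j \<in> C \<Longrightarrow> v \<subseteq> C - {j} \<Longrightarrow> A \<in> sets borel \<Longrightarrow>
      (output_prob n Q (P (insert j v)) A)\<^sup>2 \<le> B * output_prob n Q (P v) A"
  shows "\<exists>v\<subseteq>C. ennreal (s * real (card C) / (16 * B)) \<le> risk n Q (P v)"
proof -
  \<comment> \<open>The event of guessing that \<open>j\<close> belongs to \<open>v\<close>; the
    threshold is midway between the true coefficients 0 and \<open>s\<close>.\<close>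
  define A where "A j = {g. s / 2 \<le> inner g (u j)}" for j
  have A: "A j \<in> sets borel" for j
  proof -
    have "closed (A j)"
      unfolding A_def by (intro closed_Collect_le continuous_intros)
    then show ?thesis by simp
  qed
  \<comment> \<open>The probability of a wrong guess at \<open>j\<close> when \<open>v\<close> is
    the truth.\<close>
  define t where "t v j = output_prob n Q (P v) (if j \<in> v then - A j else A j)" for v j
  have sets: "sets (P v) = sets cube_measure" if "v \<subseteq> C" for v
    using f[OF that] by (auto simp: lipschitz_density_def)
  have "\<exists>v\<subseteq>C. real (card C) * (1 / (2 * B)) / 2 \<le> (\<Sum>j\<in>C. t v j)"
  proof (rule hypercube_average[OF C])
    fix v j assume j: "j \<in> C" and v: "v \<subseteq> C - {j}"
    then have ins: "insert j v \<subseteq> C" and vC: "v \<subseteq> C" and nin: "j \<notin> v" by auto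
    show "1 / (2 * B) \<le> t v j + t (insert j v) j"
      unfolding t_def using nin output_prob_Compl[OF Q P[OF ins] sets[OF ins] A]
        testing_error_ge[OF test[OF j v A] B] output_prob_nonneg output_prob_le_1[OF Q P[OF ins] sets[OF ins] A]
      by (simp add: output_prob_nonneg[OF Q P[OF ins] sets[OF ins]])
  qed
  then obtain v where v: "v \<subseteq> C" and tv: "real (card C) * (1 / (2 * B)) / 2 \<le> (\<Sum>j\<in>C. t v j)"
    by blast
  have loss: "(\<Sum>j\<in>C. s / 4 * indicator (if j \<in> v then - A j else A j) g) \<le> (norm (g - to_cube_L2 (f v)))\<^sup>2"
    for g
  proof -
    have "(\<Sum>j\<in>C. s / 4 * indicator (if j \<in> v then - A j else A j) g)
        \<le> (\<Sum>j\<in>C. (inner (g - to_cube_L2 (f v)) (u j))\<^sup>2 / s)"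
    proof (rule sum_mono)
      fix j assume j: "j \<in> C"
      let ?b = "inner (g - to_cube_L2 (f v)) (u j)"
      have b: "?b = inner g (u j) - (if j \<in> v then s else 0)"
        using sep[OF v j] by (simp add: inner_diff_left)
      \<comment> \<open>A wrong guess lies on the far side of the threshold; squaring and dividing
        by \<open>s\<close> yields the cost \<open>s / 4\<close>.\<close>
      have "s / 2 \<le> \<bar>?b\<bar>" if "g \<in> (if j \<in> v then - A j else A j)"
        using that s unfolding b by (auto simp: A_def abs_if split: if_splits)
      then have "s\<^sup>2 / 4 \<le> ?b\<^sup>2" if "g \<in> (if j \<in> v then - A j else A j)"
        using that power_mono[of "s / 2" "\<bar>?b\<bar>" 2] s by (simp add: power_divide)
      then show "s / 4 * indicator (if j \<in> v then - A j else A j) g \<le> ?b\<^sup>2 / s"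
        using s by (cases "g \<in> (if j \<in> v then - A j else A j)") (auto simp: field_simps power2_eq_square)
    qed
    also have "\<dots> \<le> (norm (g - to_cube_L2 (f v)))\<^sup>2"
      by (rule Bessel_inequality[OF C s orth])
    finally show ?thesis .
  qed
  \<comment> \<open>The 16 collects 4 from the loss, 2 from the testing error and 2 from averaging
    over pairs.\<close>
  have "s * real (card C) / (16 * B) = s / 4 * (real (card C) * (1 / (2 * B)) / 2)"
    by simp
  also have "\<dots> \<le> s / 4 * (\<Sum>j\<in>C. t v j)"
    using tv s by (intro mult_left_mono) auto
  also have "\<dots> = (\<Sum>j\<in>C. s / 4 * output_prob n Q (P v) (if j \<in> v then - A j else A j))"
    by (simp add: t_def sum_distrib_left)
  finally have "ennreal (s * real (card C) / (16 * B))
      \<le> ennreal (\<Sum>j\<in>C. s / 4 * output_prob n Q (P v) (if j \<in> v then - A j else A j))"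
    by (rule ennreal_leI)
  also have "\<dots> \<le> risk n Q (P v)"
    using s A by (intro risk_ge_output_prob[OF Q P[OF v] sets[OF v] f[OF v] C] loss) auto
  finally show ?thesis using v by blast
qed

text \<open>The acceptance probability \<open>measure (Q x) A\<close> is at most 1, so after
  tensorised Cauchy-Schwarz its square under \<open>M\<close> may be replaced by itself. This covers
  channels without any privacy.\<close>

lemma output_prob_square_le:
  assumes Q: "Q \<in> channels n" and A: "A \<in> sets borel" and "0 \<le> b"
    and M: "prob_space M" "sets M = sets cube_measure" and N: "prob_space N" "sets N = sets cube_measure"
    and step: "\<And>q. q \<in> borel_measurable M \<Longrightarrow> (\<integral>\<^sup>+y. q y \<partial>N)\<^sup>2 \<le> ennreal b * (\<integral>\<^sup>+y. (q y)\<^sup>2 \<partial>M)"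
  shows "(output_prob n Q N A)\<^sup>2 \<le> b ^ n * output_prob n Q M A"
proof -
  have "ennreal ((output_prob n Q N A)\<^sup>2) = (\<integral>\<^sup>+x. ennreal (measure (Q x) A) \<partial>PiM {..<n} (\<lambda>_. N))\<^sup>2"
    by (simp add: nn_integral_output_prob[OF Q N A] ennreal_power output_prob_nonneg[OF Q N])
  also have "\<dots> \<le> ennreal b ^ card {..<n} * (\<integral>\<^sup>+x. (ennreal (measure (Q x) A))\<^sup>2 \<partial>PiM {..<n} (\<lambda>_. M))"
    using measurable_channel_measure[OF Q A M(2)] M(2) N(2)
    by (intro nn_integral_PiM_square_le[OF M(1) N(1) _ step]) auto
  also have "\<dots> \<le> ennreal b ^ n * (\<integral>\<^sup>+x. ennreal (measure (Q x) A) \<partial>PiM {..<n} (\<lambda>_. M))"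
  proof (simp, intro mult_left_mono nn_integral_mono)
    fix x assume "x \<in> space (PiM {..<n} (\<lambda>_. M))"
    then have "x \<in> space (sample_space n)"
      using sets_eq_imp_space_eq[OF sets_PiM_sample_space[OF M(2)]] by blast
    then have "measure (Q x) A \<le> 1"
      by (intro prob_space.prob_le_1 channelsD(1)[OF Q])
    then show "(ennreal (measure (Q x) A))\<^sup>2 \<le> ennreal (measure (Q x) A)"
      by (simp add: ennreal_power power2_eq_square mult_left_le)
  qed auto
  also have "\<dots> = ennreal (b ^ n * output_prob n Q M A)"
    using \<open>0 \<le> b\<close> by (simp add: nn_integral_output_prob[OF Q M A] ennreal_power ennreal_mult output_prob_nonneg[OF Q M])
  finally show ?thesis
    using \<open>0 \<le> b\<close> by (subst (asm) ennreal_le_iff) (auto simp: output_prob_nonneg[OF Q M])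
qed

text \<open>Privacy makes the acceptance probability insensitive to each single observation, with
  ratio \<open>exp \<epsilon>\<close>, which is what the second tensorisation requires.\<close>

lemma output_prob_le_of_private:
  assumes Q: "Q \<in> private_channels n \<epsilon>" and A: "A \<in> sets borel" and "0 \<le> b" "0 \<le> \<epsilon>"
    and M: "prob_space M" "sets M = sets cube_measure" and N: "prob_space N" "sets N = sets cube_measure"
    and step: "\<And>q. q \<in> borel_measurable M \<Longrightarrow>
        (\<And>y y'. y \<in> space M \<Longrightarrow> y' \<in> space M \<Longrightarrow> q y \<le> ennreal (exp \<epsilon>) * q y') \<Longrightarrow>
        (\<integral>\<^sup>+y. q y \<partial>N) \<le> ennreal b * (\<integral>\<^sup>+y. q y \<partial>M)"
  shows "output_prob n Q N A \<le> b ^ n * output_prob n Q M A"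
proof -
  have Qc: "Q \<in> channels n" and dp: "differentially_private n \<epsilon> Q"
    using Q by (auto simp: private_channels_def)
  have "ennreal (output_prob n Q N A) = (\<integral>\<^sup>+x. ennreal (measure (Q x) A) \<partial>PiM {..<n} (\<lambda>_. N))"
    by (simp add: nn_integral_output_prob[OF Qc N A])
  also have "\<dots> \<le> ennreal b ^ card {..<n} * (\<integral>\<^sup>+x. ennreal (measure (Q x) A) \<partial>PiM {..<n} (\<lambda>_. M))"
  proof (rule nn_integral_PiM_le_of_insensitive[OF M(1) N(1) _ step])
    fix x i y assume x: "x \<in> space (PiM {..<n} (\<lambda>_. M))" and i: "i \<in> {..<n}" and y: "y \<in> space M"
    have sp: "space (PiM {..<n} (\<lambda>_. M)) = space (sample_space n)"
      by (intro sets_eq_imp_space_eq sets_PiM_sample_space M(2))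
    have x': "x(i := y) \<in> space (PiM {..<n} (\<lambda>_. M))"
      using x y i by (auto simp: space_PiM PiE_iff extensional_def)
    have "measure (Q x) A \<le> exp \<epsilon> * measure (Q (x(i := y))) A"
    \<comment> \<open>Privacy speaks only of samples that differ in exactly one entry; if the update
      changes nothing, \<open>1 \<le> exp \<epsilon>\<close> suffices.\<close>
    proof (cases "x i = y")
      case True
      then have "x(i := y) = x" by auto
      moreover have "1 * measure (Q x) A \<le> exp \<epsilon> * measure (Q x) A"
        using \<open>0 \<le> \<epsilon>\<close> by (intro mult_right_mono) auto
      ultimately show ?thesis by simp
    next
      case False
      then have "{k. k < n \<and> x k \<noteq> (x(i := y)) k} = {i}" using i by auto
      then show ?thesis
        using dp A x x' unfolding differentially_private_def sp by simp
    qed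
    then show "ennreal (measure (Q x) A) \<le> ennreal (exp \<epsilon>) * ennreal (measure (Q (x(i := y))) A)"
      by (simp add: ennreal_mult[symmetric])
  qed (use measurable_channel_measure[OF Qc A M(2)] M(2) N(2) in auto)
  also have "\<dots> = ennreal (b ^ n * output_prob n Q M A)"
    using \<open>0 \<le> b\<close> by (simp add: nn_integral_output_prob[OF Qc M A] ennreal_power ennreal_mult output_prob_nonneg[OF Qc M])
  finally show ?thesis
    using \<open>0 \<le> b\<close> by (subst (asm) ennreal_le_iff) (auto simp: output_prob_nonneg[OF Qc M])
qed

subsection \<open>Bumps\<close>

text \<open>A cone of height \<open>norm a\<close> at \<open>a\<close> minus its mirror image at
  \<open>- a\<close>, which makes the function odd and supported within radius
  \<open>2 * norm a\<close>. Dividing by 4 makes it Lipschitz with constant 1/2, leaving room for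
  two bumps to contribute to one difference.\<close>

definition bump :: "'a::euclidean_space \<Rightarrow> 'a \<Rightarrow> real"
  where "bump a u = (max 0 (norm a - norm (u - a)) - max 0 (norm a - norm (u + a))) / 4"

lemma bump_minus: "bump a (- u) = - bump a u"
proof -
  have eqs: "norm (- u - a) = norm (u + a)" "norm (- u + a) = norm (u - a)"
    by (metis add.commute minus_add_distrib norm_minus_cancel uminus_add_conv_diff)
      (metis add.commute norm_minus_commute uminus_add_conv_diff)
  show ?thesis unfolding bump_def eqs by (simp only: minus_divide_left minus_diff_eq)
qed

lemma bump_eq_0:
  assumes "2 * norm a \<le> norm u"
  shows "bump a u = 0"
  using assms norm_triangle_ineq2[of u a] norm_triangle_ineq2[of u "- a"] by (simp add: bump_def)

lemma abs_bump_le: "\<bar>bump a u\<bar> \<le> norm a / 4"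
proof -
  have "0 \<le> max 0 (norm a - norm w)" "max 0 (norm a - norm w) \<le> norm a" for w
    by simp_all
  moreover have "\<bar>(x - y) / 4\<bar> \<le> r / 4" if "0 \<le> x" "x \<le> r" "0 \<le> y" "y \<le> r" for x y r :: real
    using that by (simp add: abs_le_iff)
  ultimately show ?thesis
    unfolding bump_def by blast
qed

text \<open>Each of the two cones is 1-Lipschitz, so their difference divided by 4 has constant
  2/4.\<close>

lemma abs_bump_diff_le: "\<bar>bump a u - bump a w\<bar> \<le> norm (u - w) / 2"
proof -
  have "\<bar>norm (u - a) - norm (w - a)\<bar> \<le> norm (u - w)" "\<bar>norm (u + a) - norm (w + a)\<bar> \<le> norm (u - w)"
    using norm_triangle_ineq3[of "u - a" "w - a"] norm_triangle_ineq3[of "u + a" "w + a"] by simp_all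
  moreover have "\<bar>max 0 (r - s) - max 0 (r - t)\<bar> \<le> \<bar>s - t\<bar>" for r s t :: real
    by (auto simp: max_def abs_if)
  ultimately have "\<bar>max 0 (norm a - norm (u - a)) - max 0 (norm a - norm (w - a))\<bar> \<le> norm (u - w)"
      "\<bar>max 0 (norm a - norm (u + a)) - max 0 (norm a - norm (w + a))\<bar> \<le> norm (u - w)"
    by (meson order_trans)+
  moreover have "\<bar>(x - y) / 4 - (x' - y') / 4\<bar> \<le> d / 2" if "\<bar>x - x'\<bar> \<le> d" "\<bar>y - y'\<bar> \<le> d"
    for x y x' y' d :: real
    using that unfolding abs_le_iff by (simp add: field_simps)
  ultimately show ?thesis
    unfolding bump_def by blast
qed

text \<open>This close to \<open>a\<close> the cone at \<open>a\<close> has at least half its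
  height, and the triangle inequality puts \<open>u\<close> outside the cone at \<open>- a\<close>.
  Gives the lower bound on the squared norm.\<close>

lemma bump_ge:
  assumes "norm (u - a) \<le> norm a / 2"
  shows "norm a / 8 \<le> bump a u"
proof -
  have "2 * norm a \<le> norm (u + a) + norm (u - a)"
    using norm_triangle_ineq4[of "u + a" "u - a"] by (simp flip: scaleR_2)
  then have "norm a - norm (u + a) \<le> 0" "norm a / 2 \<le> norm a - norm (u - a)"
    using assms norm_ge_zero[of a] by linarith+
  then have "max 0 (norm a - norm (u + a)) = 0" "norm a / 2 \<le> max 0 (norm a - norm (u - a))"
    by (simp_all add: max_absorb1 le_max_iff_disj)
  then show ?thesis
    unfolding bump_def by simp
qed

lemma continuous_on_bump [continuous_intros]:
  "continuous_on S g \<Longrightarrow> continuous_on S (\<lambda>x. bump a (g x))"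
  unfolding bump_def by (intro continuous_intros) auto

lemma borel_measurable_bump [measurable]: "bump a \<in> borel_measurable borel"
  by (intro borel_measurable_continuous_onI continuous_intros)

section \<open>Integrals of a bump and of its powers\<close>

lemma abs_bump_power_le: "\<bar>bump a u\<bar> ^ k \<le> (norm a / 4) ^ k * indicator (ball 0 (2 * norm a)) u" if "0 < k"
proof (cases "norm u < 2 * norm a")
  case True
  then show ?thesis using power_mono[OF abs_bump_le, of a u k] by simp
qed (use that in \<open>simp add: bump_eq_0 zero_power\<close>)

lemma measure_lborel_ball:
  "0 \<le> r \<Longrightarrow> measure lborel (ball (c::'a::euclidean_space) r) = unit_ball_vol (real DIM('a)) * r ^ DIM('a)"
  using content_ball[of r c] by simp

lemma integrable_indicator_ball:
  "integrable lborel (\<lambda>u. K * indicator (ball (c::'a::euclidean_space) r) u :: real)"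
proof -
  have "emeasure lborel (ball c r) < \<infinity>"
    by (rule emeasure_bounded_finite) simp
  then show ?thesis by (intro integrable_mult_right integrable_real_indicator) auto
qed

lemma integrable_abs_bump_power:
  assumes "0 < k"
  shows "integrable lborel (\<lambda>u. \<bar>bump a u\<bar> ^ k)"
proof (rule Bochner_Integration.integrable_bound[OF integrable_indicator_ball])
  show "AE u in lborel. norm (\<bar>bump a u\<bar> ^ k)
      \<le> norm ((norm a / 4) ^ k * indicator (ball 0 (2 * norm a)) u :: real)"
    using abs_bump_power_le[OF assms, of a] by (intro AE_I2) (simp add: abs_mult)
qed simp

text \<open>Height times volume of a ball containing the support; \<open>k = 1\<close> serves the
  privacy bound and \<open>k = 2\<close> the Cauchy-Schwarz bound.\<close>

lemma integral_abs_bump_power_le: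
  fixes a :: "'a::euclidean_space"
  assumes "0 < k"
  shows "(\<integral>u. \<bar>bump a u\<bar> ^ k \<partial>lborel)
    \<le> (norm a / 4) ^ k * (unit_ball_vol (real DIM('a)) * (2 * norm a) ^ DIM('a))"
proof -
  have "(\<integral>u. \<bar>bump a u\<bar> ^ k \<partial>lborel) \<le> (\<integral>u. (norm a / 4) ^ k * indicator (ball (0::'a) (2 * norm a)) u \<partial>lborel)"
    by (intro integral_mono integrable_abs_bump_power integrable_indicator_ball abs_bump_power_le assms)
  then show ?thesis by (simp add: measure_lborel_ball)
qed

lemma integral_bump_square_ge:
  fixes a :: "'a::euclidean_space"
  shows "(norm a / 8)\<^sup>2 * (unit_ball_vol (real DIM('a)) * (norm a / 2) ^ DIM('a))
    \<le> (\<integral>u. (bump a u)\<^sup>2 \<partial>lborel)"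
proof -
  have "(norm a / 8)\<^sup>2 * indicator (ball a (norm a / 2)) u \<le> (bump a u)\<^sup>2" for u
  proof (cases "u \<in> ball a (norm a / 2)")
    case True
    then have "norm a / 8 \<le> bump a u"
      by (intro bump_ge) (simp add: dist_norm norm_minus_commute)
    then show ?thesis using True power_mono[of "norm a / 8" "bump a u" 2] by simp
  qed simp
  then have "(\<integral>u. (norm a / 8)\<^sup>2 * indicator (ball a (norm a / 2)) u \<partial>lborel) \<le> (\<integral>u. (bump a u)\<^sup>2 \<partial>lborel)"
    using integrable_abs_bump_power[of 2 a] by (intro integral_mono integrable_indicator_ball) auto
  then show ?thesis by (simp add: measure_lborel_ball)
qed

text \<open>Lebesgue measure is invariant under reflection and the bump is odd, so the integral
  equals its own negative.\<close>

lemma integral_bump_eq_0: "(\<integral>u. bump a u \<partial>lborel) = 0" for a :: "'a::euclidean_space"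
proof -
  have "distr lborel borel (uminus :: 'a \<Rightarrow> 'a) = lborel"
    using lborel_affine[of "-1" "0::'a"] by (simp add: density_1 fun_Compl_def uminus_apply[abs_def])
  then have "(\<integral>u. bump a u \<partial>lborel) = (\<integral>u. bump a u \<partial>distr lborel borel uminus)"
    by simp
  also have "\<dots> = (\<integral>u. bump a (- u) \<partial>lborel)"
    by (rule integral_distr) simp_all
  also have "\<dots> = - (\<integral>u. bump a u \<partial>lborel)"
    by (simp add: bump_minus)
  finally show ?thesis by simp
qed

text \<open>The support of the shifted function stays inside the cube, so restricting to the cube
  loses nothing and translation invariance applies.\<close>

lemma cube_integral_translate:
  fixes F :: "real^'d \<Rightarrow> real"
  assumes F: "F \<in> borel_measurable borel" "\<And>u. R \<le> norm u \<Longrightarrow> F u = 0" and c: "ball c R \<subseteq> unit_cube"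
  shows "(\<integral>x. F (x - c) \<partial>cube_measure) = (\<integral>u. F u \<partial>lborel)"
proof -
  have "(\<integral>x. F (x - c) \<partial>cube_measure) = (\<integral>x. indicator unit_cube x *\<^sub>R F (x - c) \<partial>lborel)"
    unfolding cube_measure_def by (rule integral_restrict_space) (simp add: unit_cube_def)
  also have "\<dots> = (\<integral>x. F (- c + x) \<partial>lborel)"
  proof (rule Bochner_Integration.integral_cong[OF refl])
    fix x
    show "indicator unit_cube x *\<^sub>R F (x - c) = F (- c + x)"
    proof (cases "x \<in> unit_cube")
      case False
      then have "R \<le> norm (x - c)"
        using c by (force simp: dist_norm norm_minus_commute)
      then show ?thesis using False F(2) by simp
    qed simp
  qed
  also have "\<dots> = (\<integral>u. F u \<partial>distr lborel borel ((+) (- c)))"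
    using F(1) by (subst integral_distr) auto
  finally show ?thesis by (simp add: lborel_distr_plus)
qed

lemma cube_measure_continuous:
  fixes f :: "real^'d \<Rightarrow> real"
  assumes "continuous_on unit_cube f"
  shows "f \<in> borel_measurable cube_measure" "integrable cube_measure f"
proof -
  have "f \<in> borel_measurable (restrict_space borel unit_cube)"
    using assms by (rule borel_measurable_continuous_on_restrict)
  then show f: "f \<in> borel_measurable cube_measure"
    using measurable_cong_sets[OF sets_restrict_borel_cube refl] by blast
  have "bounded (f ` unit_cube)"
    using assms by (intro compact_imp_bounded compact_continuous_image) (auto simp: unit_cube_def)
  then obtain B where "\<And>t. t \<in> unit_cube \<Longrightarrow> \<bar>f t\<bar> \<le> B"
    by (auto simp: bounded_iff)
  then show "integrable cube_measure f"
    using f by (intro cube_measure.integrable_const_bound[where B=B]) auto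
qed

lemma continuous_square_integrable:
  "continuous_on unit_cube f \<Longrightarrow> square_integrable f"
  unfolding square_integrable_def by (intro conjI cube_measure_continuous continuous_intros)

lemma inner_to_cube_L2:
  "square_integrable f \<Longrightarrow> square_integrable g \<Longrightarrow>
    inner (to_cube_L2 f) (to_cube_L2 g) = (\<integral>t. f t * g t \<partial>cube_measure)"
  by (intro inner_cube_L2.abs_eq) (simp_all add: cube_L2_rel_def)

text \<open>A bump lives in a ball of radius \<open>2 * norm a\<close>; the last two conditions keep
  these balls inside the cube and disjoint. The bound \<open>norm a \<le> 1\<close> keeps
  perturbations below 1/4, so densities stay positive.\<close>

locale bump_family =
  fixes a :: "real^'d" and C :: "(real^'d) set"
  assumes finite_C: "finite C"
    and norm_a: "0 < norm a" "norm a \<le> 1"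
    and ball_C: "\<And>c. c \<in> C \<Longrightarrow> ball c (2 * norm a) \<subseteq> unit_cube"
    and dist_C: "\<And>c c'. c \<in> C \<Longrightarrow> c' \<in> C \<Longrightarrow> c \<noteq> c' \<Longrightarrow> 4 * norm a \<le> dist c c'"
begin

definition perturbed :: "(real^'d) set \<Rightarrow> real^'d \<Rightarrow> real"
  where "perturbed v x = 1 + (\<Sum>c\<in>v. bump a (x - c))"

definition perturbed_measure :: "(real^'d) set \<Rightarrow> (real^'d) measure"
  where "perturbed_measure v = density cube_measure (\<lambda>t. ennreal (perturbed v t))"

lemma bump_disjoint:
  assumes "c \<in> C" "c' \<in> C" "bump a (x - c) \<noteq> 0" "bump a (x - c') \<noteq> 0"
  shows "c = c'"
proof (rule ccontr)
  assume "c \<noteq> c'"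
  then have "4 * norm a \<le> dist c c'" using assms dist_C by blast
  also have "\<dots> \<le> norm (x - c) + norm (x - c')"
    using dist_triangle2[of c c' x] by (simp add: dist_norm norm_minus_commute)
  finally have "2 * norm a \<le> norm (x - c) \<or> 2 * norm a \<le> norm (x - c')" by linarith
  then show False using assms bump_eq_0 by blast
qed

lemma sum_bump_cases:
  assumes "v \<subseteq> C"
  obtains "\<And>c. c \<in> v \<Longrightarrow> bump a (x - c) = 0"
  | b where "b \<in> v" "\<And>c. c \<in> v \<Longrightarrow> c \<noteq> b \<Longrightarrow> bump a (x - c) = 0"
proof (cases "\<exists>b\<in>v. bump a (x - b) \<noteq> 0")
  case True
  then obtain b where b: "b \<in> v" "bump a (x - b) \<noteq> 0" by blast
  then have "bump a (x - c) = 0" if "c \<in> v" "c \<noteq> b" for c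
    using that assms bump_disjoint[of c b x] by blast
  with b(1) show thesis by (rule that(2))
qed (use that(1) in blast)

lemma abs_sum_bump_le:
  assumes "v \<subseteq> C"
  shows "\<bar>\<Sum>c\<in>v. bump a (x - c)\<bar> \<le> 1 / 4"
  using assms
proof (cases rule: sum_bump_cases[of v x])
  case (2 b)
  have "(\<Sum>c\<in>v. bump a (x - c)) = (\<Sum>c\<in>{b}. bump a (x - c))"
    using assms 2 finite_subset[OF _ finite_C] by (intro sum.mono_neutral_right) auto
  then show ?thesis using abs_bump_le[of a "x - b"] norm_a by simp
qed simp

lemma perturbed_bounds:
  assumes "v \<subseteq> C"
  shows "3 / 4 \<le> perturbed v x" "perturbed v x \<le> 5 / 4"
  using abs_sum_bump_le[OF assms, of x] unfolding perturbed_def by linarith+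

text \<open>At most one bump is nonzero at \<open>x\<close> and at most one at \<open>y\<close>, so
  at most two summands of the difference survive, each Lipschitz with constant 1/2.\<close>

lemma perturbed_lipschitz:
  assumes v: "v \<subseteq> C"
  shows "1-lipschitz_on unit_cube (perturbed v)"
proof (rule lipschitz_onI)
  fix x y :: "real^'d"
  define I where "I = {c \<in> v. bump a (x - c) \<noteq> 0 \<or> bump a (y - c) \<noteq> 0}"
  have fin: "finite v" using v finite_C by (rule finite_subset)
  have one: "card {c \<in> v. bump a (z - c) \<noteq> 0} \<le> 1" for z
    using v fin by (subst One_nat_def, subst card_le_Suc0_iff_eq) (auto dest: bump_disjoint)
  have "card I \<le> card ({c \<in> v. bump a (x - c) \<noteq> 0} \<union> {c \<in> v. bump a (y - c) \<noteq> 0})"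
    using fin by (intro card_mono) (auto simp: I_def)
  also have "\<dots> \<le> 2"
    using one[of x] one[of y] by (intro card_Un_le[THEN order_trans]) linarith
  finally have card: "card I \<le> 2" .
  have "dist (perturbed v x) (perturbed v y) = \<bar>\<Sum>c\<in>v. bump a (x - c) - bump a (y - c)\<bar>"
    by (simp add: perturbed_def dist_real_def sum_subtractf)
  also have "(\<Sum>c\<in>v. bump a (x - c) - bump a (y - c)) = (\<Sum>c\<in>I. bump a (x - c) - bump a (y - c))"
    using fin by (intro sum.mono_neutral_right) (auto simp: I_def)
  also have "\<bar>\<dots>\<bar> \<le> (\<Sum>c\<in>I. norm (x - y) / 2)"
    using abs_bump_diff_le[of a "x - c" "y - c" for c] by (intro order_trans[OF sum_abs] sum_mono) simp
  also have "\<dots> = real (card I) * (norm (x - y) / 2)" by simp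
  also have "\<dots> \<le> 2 * (norm (x - y) / 2)"
    using card by (intro mult_right_mono) auto
  finally show "dist (perturbed v x) (perturbed v y) \<le> 1 * dist x y"
    by (simp add: dist_norm)
qed simp

lemma continuous_on_perturbed: "continuous_on S (perturbed v)"
  unfolding perturbed_def by (intro continuous_intros)

lemma continuous_on_shifted_bump: "continuous_on S (\<lambda>x. bump a (x - c))"
  by (intro continuous_intros)

section \<open>Integrals and inner products of the perturbed densities\<close>

lemma cube_integral_bump: "c \<in> C \<Longrightarrow> (\<integral>x. bump a (x - c) \<partial>cube_measure) = 0"
  using cube_integral_translate[OF borel_measurable_bump[of a] bump_eq_0 ball_C]
  by (simp add: integral_bump_eq_0)

lemma cube_integral_bump_square:
  "c \<in> C \<Longrightarrow> (\<integral>x. (bump a (x - c))\<^sup>2 \<partial>cube_measure) = (\<integral>u. (bump a u)\<^sup>2 \<partial>lborel)"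
  by (intro cube_integral_translate[where R="2 * norm a"] ball_C) (auto simp: bump_eq_0)

lemma cube_integral_abs_bump:
  "c \<in> C \<Longrightarrow> (\<integral>x. \<bar>bump a (x - c)\<bar> \<partial>cube_measure) = (\<integral>u. \<bar>bump a u\<bar> \<partial>lborel)"
  by (intro cube_integral_translate[where R="2 * norm a"] ball_C) (auto simp: bump_eq_0)

lemma cube_integral_perturbed:
  assumes "v \<subseteq> C"
  shows "(\<integral>x. perturbed v x \<partial>cube_measure) = 1"
proof -
  have "(\<integral>x. perturbed v x \<partial>cube_measure) = 1 + (\<Sum>c\<in>v. \<integral>x. bump a (x - c) \<partial>cube_measure)"
    unfolding perturbed_def
    by (subst Bochner_Integration.integral_add)
      (auto simp: cube_measure.prob_space[simplified] intro!: Bochner_Integration.integrable_sum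
        cube_measure_continuous continuous_on_shifted_bump continuous_on_sum Bochner_Integration.integral_sum)
  also have "(\<Sum>c\<in>v. \<integral>x. bump a (x - c) \<partial>cube_measure) = 0"
    using assms by (intro sum.neutral) (auto simp: cube_integral_bump)
  finally show ?thesis by simp
qed

lemma prob_space_perturbed:
  assumes "v \<subseteq> C"
  shows "prob_space (perturbed_measure v)"
proof
  have "perturbed v \<in> borel_measurable cube_measure"
    by (intro cube_measure_continuous continuous_on_perturbed)
  then have "emeasure (density cube_measure (\<lambda>t. ennreal (perturbed v t))) (space cube_measure)
      = (\<integral>\<^sup>+x. ennreal (perturbed v x) \<partial>cube_measure)"
    by (subst emeasure_density) (auto intro!: nn_integral_cong simp del: space_cube_measure)
  also have "\<dots> = ennreal (\<integral>x. perturbed v x \<partial>cube_measure)"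
    using perturbed_bounds(1)[OF assms]
    by (intro nn_integral_eq_integral cube_measure_continuous continuous_on_perturbed AE_I2)
      (auto intro: order_trans[of 0 "3 / 4"])
  finally show "emeasure (perturbed_measure v) (space (perturbed_measure v)) = 1"
    by (simp add: cube_integral_perturbed assms perturbed_measure_def)
qed

lemma sets_perturbed: "sets (perturbed_measure v) = sets cube_measure"
  by (simp add: perturbed_measure_def)

lemma lipschitz_density_perturbed:
  assumes "v \<subseteq> C"
  shows "lipschitz_density (perturbed_measure v) (perturbed v)"
  unfolding lipschitz_density_def perturbed_measure_def
  using perturbed_lipschitz[OF assms] perturbed_bounds(1)[OF assms]
  by (auto intro: order_trans[of 0 "3/4"])

lemma perturbed_in_lipschitz_distributions:
  "v \<subseteq> C \<Longrightarrow> perturbed_measure v \<in> lipschitz_distributions"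
  using lipschitz_density_perturbed prob_space_perturbed by (auto simp: lipschitz_distributions_def)

lemma inner_shifted_bumps:
  assumes "c \<in> C" "c' \<in> C"
  shows "inner (to_cube_L2 (\<lambda>x. bump a (x - c))) (to_cube_L2 (\<lambda>x. bump a (x - c')))
    = (if c = c' then \<integral>u. (bump a u)\<^sup>2 \<partial>lborel else 0)"
proof -
  have "bump a (x - c) * bump a (x - c') = (if c = c' then (bump a (x - c))\<^sup>2 else 0)" for x
    using bump_disjoint[OF assms, of x] by (auto simp: power2_eq_square)
  then show ?thesis
    using assms cube_integral_bump_square
    by (simp add: inner_to_cube_L2 continuous_square_integrable continuous_on_shifted_bump)
qed

text \<open>The uniform part drops out because bumps have integral zero, and the other bumps by
  disjointness. The coefficient therefore reveals whether \<open>j\<close> is in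
  \<open>v\<close>.\<close>

lemma inner_perturbed_bump:
  assumes v: "v \<subseteq> C" and j: "j \<in> C"
  shows "inner (to_cube_L2 (perturbed v)) (to_cube_L2 (\<lambda>x. bump a (x - j)))
    = (if j \<in> v then \<integral>u. (bump a u)\<^sup>2 \<partial>lborel else 0)"
proof -
  have fin: "finite v" using v finite_C by (rule finite_subset)
  have *: "bump a (x - c) * bump a (x - j) = (if c = j then (bump a (x - j))\<^sup>2 else 0)" if "c \<in> v" for x c
    using bump_disjoint[of c j x] that v j by (auto simp: power2_eq_square)
  have "perturbed v x * bump a (x - j)
      = bump a (x - j) + (if j \<in> v then (bump a (x - j))\<^sup>2 else 0)" for x
    using fin * by (simp add: perturbed_def distrib_right sum_distrib_right)
  then have "inner (to_cube_L2 (perturbed v)) (to_cube_L2 (\<lambda>x. bump a (x - j)))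
     = (\<integral>x. bump a (x - j) + (if j \<in> v then (bump a (x - j))\<^sup>2 else 0) \<partial>cube_measure)"
    by (simp add: inner_to_cube_L2 continuous_square_integrable continuous_on_shifted_bump continuous_on_perturbed)
  also have "\<dots> = (if j \<in> v then \<integral>u. (bump a u)\<^sup>2 \<partial>lborel else 0)"
    using j cube_integral_bump cube_integral_bump_square
    by (auto simp: cube_measure_continuous continuous_on_shifted_bump continuous_on_power)
  finally show ?thesis .
qed

lemma integral_bump_square_pos: "0 < (\<integral>u. (bump a u)\<^sup>2 \<partial>lborel)"
proof -
  have "0 < (norm a / 8)\<^sup>2 * (unit_ball_vol (real DIM(real^'d)) * (norm a / 2) ^ DIM(real^'d))"
    using norm_a by (intro mult_pos_pos zero_less_power unit_ball_vol_pos) auto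
  also note integral_bump_square_ge
  finally show ?thesis .
qed

section \<open>The cost per observation of switching one bump on\<close>

lemma perturbed_insert:
  assumes "v \<subseteq> C - {j}"
  shows "perturbed (insert j v) x = perturbed v x + bump a (x - j)"
proof -
  have "finite v" "j \<notin> v" using assms finite_C by (auto intro: finite_subset)
  then show ?thesis by (simp add: perturbed_def)
qed

lemma chi_square_step:
  assumes j: "j \<in> C" and v: "v \<subseteq> C - {j}" and q: "q \<in> borel_measurable (perturbed_measure v)"
  shows "(\<integral>\<^sup>+y. q y \<partial>perturbed_measure (insert j v))\<^sup>2
    \<le> ennreal (1 + 2 * (\<integral>u. (bump a u)\<^sup>2 \<partial>lborel)) * (\<integral>\<^sup>+y. (q y)\<^sup>2 \<partial>perturbed_measure v)"
  unfolding perturbed_measure_def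
proof (rule nn_integral_density_square_le)
  have vC: "v \<subseteq> C" and iC: "insert j v \<subseteq> C" using v j by auto
  show "0 < perturbed v t" "0 \<le> perturbed (insert j v) t" for t
    using perturbed_bounds(1)[OF vC, of t] perturbed_bounds(1)[OF iC, of t] by linarith+
  show "q \<in> borel_measurable cube_measure"
    using q by (simp add: measurable_cong_sets[OF sets_perturbed refl])
  \<comment> \<open>Expanding \<open>(f + b)^2 / f\<close> gives \<open>f + 2 * b + b^2 / f\<close>,
    and \<open>1 / f \<le> 2\<close> since \<open>f\<close> is at least 3/4. The linear term
    integrates to zero.\<close>
  let ?h = "\<lambda>t. perturbed v t + 2 * bump a (t - j) + 2 * (bump a (t - j))\<^sup>2"
  have le: "(perturbed (insert j v) t)\<^sup>2 / perturbed v t \<le> ?h t" for t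
  proof -
    let ?f = "perturbed v t" and ?b = "bump a (t - j)"
    have f: "3 / 4 \<le> ?f" by (rule perturbed_bounds(1)[OF vC])
    have "?b\<^sup>2 * 1 \<le> ?b\<^sup>2 * (2 * ?f)"
      using f by (intro mult_left_mono) auto
    then have "(?f + ?b)\<^sup>2 \<le> ?h t * ?f"
      by (simp add: power2_eq_square algebra_simps)
    then show ?thesis
      using f by (simp add: perturbed_insert[OF v] divide_le_eq)
  qed
  have cont: "continuous_on unit_cube ?h"
    by (intro continuous_intros continuous_on_perturbed)
  have nonneg: "0 \<le> ?h t" for t
    by (rule order_trans[OF _ le]) (use perturbed_bounds(1)[OF vC, of t] in simp)
  have "(\<integral>\<^sup>+t. ennreal ((perturbed (insert j v) t)\<^sup>2 / perturbed v t) \<partial>cube_measure)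
      \<le> (\<integral>\<^sup>+t. ennreal (?h t) \<partial>cube_measure)"
    by (intro nn_integral_mono ennreal_leI le)
  also have "\<dots> = ennreal (\<integral>t. ?h t \<partial>cube_measure)"
    by (intro nn_integral_eq_integral cube_measure_continuous cont AE_I2 nonneg)
  also have "(\<integral>t. ?h t \<partial>cube_measure) = 1 + 2 * (\<integral>u. (bump a u)\<^sup>2 \<partial>lborel)"
    using cube_integral_perturbed[OF vC] cube_integral_bump[OF j] cube_integral_bump_square[OF j]
    by (simp add: cube_measure_continuous continuous_on_shifted_bump continuous_on_power continuous_on_perturbed)
  finally show "(\<integral>\<^sup>+t. ennreal ((perturbed (insert j v) t)\<^sup>2 / perturbed v t) \<partial>cube_measure)
    \<le> ennreal (1 + 2 * (\<integral>u. (bump a u)\<^sup>2 \<partial>lborel))" .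
qed (intro cube_measure_continuous continuous_on_perturbed)+

text \<open>The transport bound with \<open>K = exp \<epsilon> - 1\<close>. The mass to be moved is
  half the \<open>L^1\<close> norm of the bump, and is bounded here by the full norm.\<close>

lemma private_step:
  assumes j: "j \<in> C" and v: "v \<subseteq> C - {j}" and "0 \<le> \<epsilon>"
    and q: "q \<in> borel_measurable (perturbed_measure v)"
      "\<And>y y'. y \<in> space (perturbed_measure v) \<Longrightarrow> y' \<in> space (perturbed_measure v) \<Longrightarrow>
        q y \<le> ennreal (exp \<epsilon>) * q y'"
  shows "(\<integral>\<^sup>+y. q y \<partial>perturbed_measure (insert j v))
    \<le> ennreal (1 + (\<integral>u. \<bar>bump a u\<bar> \<partial>lborel) * (exp \<epsilon> - 1)) * (\<integral>\<^sup>+y. q y \<partial>perturbed_measure v)"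
proof -
  have vC: "v \<subseteq> C" and iC: "insert j v \<subseteq> C" using v j by auto
  let ?\<tau> = "\<integral>u. \<bar>bump a u\<bar> \<partial>lborel"
  have \<tau>: "0 \<le> ?\<tau>" by simp
  have pos: "(\<integral>\<^sup>+t. ennreal (s * bump a (t - j)) \<partial>cube_measure) = ennreal (?\<tau> / 2)" if s: "\<bar>s\<bar> = 1" for s :: real
  proof -
    \<comment> \<open>The positive part of \<open>z\<close> is
      \<open>(\<bar>z\<bar> + z) / 2\<close>; the signs \<open>s = 1\<close> and
      \<open>s = -1\<close> give the two excess masses, which agree because the bump has integral
      zero.\<close>
    have "ennreal (s * bump a (t - j)) = ennreal ((\<bar>bump a (t - j)\<bar> + s * bump a (t - j)) / 2)" for t
      using s by (cases "0 \<le> s * bump a (t - j)") (auto simp: abs_if ennreal_neg split: if_splits)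
    then have "(\<integral>\<^sup>+t. ennreal (s * bump a (t - j)) \<partial>cube_measure)
        = (\<integral>\<^sup>+t. ennreal ((\<bar>bump a (t - j)\<bar> + s * bump a (t - j)) / 2) \<partial>cube_measure)"
      by simp
    also have "\<dots> = ennreal (\<integral>t. (\<bar>bump a (t - j)\<bar> + s * bump a (t - j)) / 2 \<partial>cube_measure)"
      using s by (intro nn_integral_eq_integral cube_measure_continuous continuous_intros AE_I2)
        (auto simp: abs_if split: if_splits)
    also have "(\<integral>t. (\<bar>bump a (t - j)\<bar> + s * bump a (t - j)) / 2 \<partial>cube_measure) = ?\<tau> / 2"
      using cube_integral_bump[OF j] cube_integral_abs_bump[OF j]
      by (simp add: cube_measure_continuous continuous_on_shifted_bump continuous_on_rabs)
    finally show ?thesis .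
  qed
  have up: "(\<integral>\<^sup>+t. ennreal (perturbed (insert j v) t - perturbed v t) \<partial>cube_measure) = ennreal (?\<tau> / 2)"
    using pos[of 1] by (simp add: perturbed_insert[OF v])
  have down: "(\<integral>\<^sup>+t. ennreal (perturbed v t - perturbed (insert j v) t) \<partial>cube_measure) = ennreal (?\<tau> / 2)"
    using pos[of "-1"] by (simp add: perturbed_insert[OF v])
  have exp: "1 + ennreal (exp \<epsilon> - 1) = ennreal (exp \<epsilon>)"
    using \<open>0 \<le> \<epsilon>\<close> by (simp flip: ennreal_1 ennreal_plus)
  have "(\<integral>\<^sup>+y. q y \<partial>perturbed_measure (insert j v))
      \<le> (1 + ennreal ?\<tau> * ennreal (exp \<epsilon> - 1)) * (\<integral>\<^sup>+y. q y \<partial>perturbed_measure v)"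
    unfolding perturbed_measure_def
  proof (rule nn_integral_density_le_of_insensitive)
    show "0 \<le> perturbed v t" "0 \<le> perturbed (insert j v) t" for t
      using perturbed_bounds(1)[OF vC, of t] perturbed_bounds(1)[OF iC, of t] by linarith+
    show "prob_space (density cube_measure (\<lambda>t. ennreal (perturbed v t)))"
      using prob_space_perturbed[OF vC] by (simp add: perturbed_measure_def)
    show "q \<in> borel_measurable cube_measure"
      using q(1) by (simp add: measurable_cong_sets[OF sets_perturbed refl])
    show "q t \<le> (1 + ennreal (exp \<epsilon> - 1)) * q t'"
      if "t \<in> space cube_measure" "t' \<in> space cube_measure" for t t'
      unfolding exp using q(2)[of t t'] that by (simp add: perturbed_measure_def)
  qed (use \<tau> in \<open>auto simp: up down intro!: ennreal_leI cube_measure_continuous continuous_on_perturbed\<close>)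
  also have "1 + ennreal ?\<tau> * ennreal (exp \<epsilon> - 1) = ennreal (1 + ?\<tau> * (exp \<epsilon> - 1))"
    using \<tau> \<open>0 \<le> \<epsilon>\<close> by (simp flip: ennreal_1 ennreal_plus ennreal_mult)
  finally show ?thesis .
qed

lemma sup_risk_ge:
  fixes Q :: "(nat \<Rightarrow> real^'d) \<Rightarrow> 'd cube_L2 measure"
  assumes Q: "Q \<in> channels n"
  shows "ennreal ((\<integral>u. (bump a u)\<^sup>2 \<partial>lborel) * real (card C) / (16 * (1 + 2 * (\<integral>u. (bump a u)\<^sup>2 \<partial>lborel)) ^ n))
    \<le> (SUP P\<in>lipschitz_distributions. risk n Q P)"
proof -
  let ?s = "\<integral>u. (bump a u)\<^sup>2 \<partial>lborel"
  have "\<exists>v\<subseteq>C. ennreal (?s * real (card C) / (16 * (1 + 2 * ?s) ^ n)) \<le> risk n Q (perturbed_measure v)"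
  proof (rule assouad_risk_ge[where B="(1 + 2 * ?s) ^ n" and P=perturbed_measure and f=perturbed
        and u="\<lambda>c. to_cube_L2 (\<lambda>x. bump a (x - c))", OF Q finite_C integral_bump_square_pos])
    show "1 \<le> (1 + 2 * ?s) ^ n"
      using integral_bump_square_pos by (intro one_le_power) simp
    fix v j A assume j: "j \<in> C" and v: "v \<subseteq> C - {j}" and A: "A \<in> sets (borel :: 'd cube_L2 measure)"
    then have "insert j v \<subseteq> C" "v \<subseteq> C" by auto
    then show "(output_prob n Q (perturbed_measure (insert j v)) A)\<^sup>2
        \<le> (1 + 2 * ?s) ^ n * output_prob n Q (perturbed_measure v) A"
      using integral_bump_square_pos
      by (intro output_prob_square_le[OF Q A] chi_square_step[OF j v] prob_space_perturbed sets_perturbed) auto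
  qed (rule prob_space_perturbed lipschitz_density_perturbed inner_shifted_bumps inner_perturbed_bump; assumption)+
  then show ?thesis
    using perturbed_in_lipschitz_distributions by (elim exE conjE) (rule SUP_upper2)
qed

lemma sup_risk_ge_of_private:
  fixes Q :: "(nat \<Rightarrow> real^'d) \<Rightarrow> 'd cube_L2 measure"
  assumes Q: "Q \<in> private_channels n \<epsilon>" and "0 \<le> \<epsilon>"
  shows "ennreal ((\<integral>u. (bump a u)\<^sup>2 \<partial>lborel) * real (card C) /
      (16 * (1 + (\<integral>u. \<bar>bump a u\<bar> \<partial>lborel) * (exp \<epsilon> - 1)) ^ n))
    \<le> (SUP P\<in>lipschitz_distributions. risk n Q P)"
proof -
  let ?s = "\<integral>u. (bump a u)\<^sup>2 \<partial>lborel" and ?b = "1 + (\<integral>u. \<bar>bump a u\<bar> \<partial>lborel) * (exp \<epsilon> - 1)"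
  have Qc: "Q \<in> channels n" using Q by (simp add: private_channels_def)
  have b: "1 \<le> ?b" using \<open>0 \<le> \<epsilon>\<close> by simp
  have "\<exists>v\<subseteq>C. ennreal (?s * real (card C) / (16 * ?b ^ n)) \<le> risk n Q (perturbed_measure v)"
  proof (rule assouad_risk_ge[where B="?b ^ n" and P=perturbed_measure and f=perturbed
        and u="\<lambda>c. to_cube_L2 (\<lambda>x. bump a (x - c))", OF Qc finite_C integral_bump_square_pos])
    show "1 \<le> ?b ^ n"
      using b by (rule one_le_power)
    fix v j A assume j: "j \<in> C" and v: "v \<subseteq> C - {j}" and A: "A \<in> sets (borel :: 'd cube_L2 measure)"
    then have iC: "insert j v \<subseteq> C" and vC: "v \<subseteq> C" by auto
    let ?o = "output_prob n Q (perturbed_measure (insert j v)) A"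
    \<comment> \<open>Privacy gives a linear inequality; a probability dominates its square, which
      brings it into the form required for testing.\<close>
    have "?o\<^sup>2 \<le> ?o"
      using output_prob_nonneg[OF Qc prob_space_perturbed[OF iC] sets_perturbed]
        output_prob_le_1[OF Qc prob_space_perturbed[OF iC] sets_perturbed A]
      by (simp add: power2_eq_square mult_left_le)
    also have "?o \<le> ?b ^ n * output_prob n Q (perturbed_measure v) A"
      using b iC vC \<open>0 \<le> \<epsilon>\<close>
      by (intro output_prob_le_of_private[OF Q A] private_step[OF j v] prob_space_perturbed sets_perturbed) auto
    finally show "?o\<^sup>2 \<le> ?b ^ n * output_prob n Q (perturbed_measure v) A" .
  qed (rule prob_space_perturbed lipschitz_density_perturbed inner_shifted_bumps inner_perturbed_bump; assumption)+
  then show ?thesis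
    using perturbed_in_lipschitz_distributions by (elim exE conjE) (rule SUP_upper2)
qed

end

subsection \<open>Choice of the resolution\<close>

lemma cube_grid:
  assumes m: "1 \<le> m"
  obtains C :: "(real^'d) set" where "finite C" "card C = m ^ CARD('d)"
    "\<And>c. c \<in> C \<Longrightarrow> ball c (1 / (2 * real m)) \<subseteq> unit_cube"
    "\<And>c c'. c \<in> C \<Longrightarrow> c' \<in> C \<Longrightarrow> c \<noteq> c' \<Longrightarrow> 1 / real m \<le> dist c c'"
proof -
  let ?K = "(UNIV :: 'd set) \<rightarrow>\<^sub>E {..<m}"
  \<comment> \<open>The shift by 1/2 selects cell centres, so that balls of radius
    \<open>1 / (2 * real m)\<close> fit inside the cells.\<close>
  define g :: "('d \<Rightarrow> nat) \<Rightarrow> real^'d" where "g k = (\<chi> i. (real (k i) + 1 / 2) / real m)" for k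
  have m0: "0 < real m" using m by simp
  have diff: "1 / real m \<le> dist (g k) (g l)" if "k \<noteq> l" for k l
  proof -
    obtain i where i: "k i \<noteq> l i" using \<open>k \<noteq> l\<close> by blast
    \<comment> \<open>Distinct naturals differ by at least 1, and one coordinate already bounds the
      distance from below.\<close>
    have "1 / real m \<le> \<bar>real (k i) - real (l i)\<bar> / real m"
      using i m0 by (intro divide_right_mono) linarith+
    also have "\<dots> = \<bar>(g k - g l) $ i\<bar>"
      using m0 by (simp add: g_def diff_divide_distrib[symmetric])
    also have "\<dots> \<le> dist (g k) (g l)"
      unfolding dist_norm by (rule component_le_norm_cart)
    finally show ?thesis .
  qed
  have inj: "inj_on g ?K"
  proof (rule inj_onI, rule ccontr)
    fix k l assume "g k = g l" "k \<noteq> l"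
    then show False using diff[of k l] m0 by simp
  qed
  show thesis
  proof (rule that)
    show "finite (g ` ?K)" by (simp add: finite_PiE)
    show "card (g ` ?K) = m ^ CARD('d)"
      by (simp add: card_image[OF inj] card_PiE)
    show "ball c (1 / (2 * real m)) \<subseteq> unit_cube" if c: "c \<in> g ` ?K" for c
    proof
      fix x assume x: "x \<in> ball c (1 / (2 * real m))"
      obtain k where k: "k \<in> ?K" "c = g k" using c by blast
      have "0 \<le> x $ i \<and> x $ i \<le> 1" for i
      proof -
        have "\<bar>(x - c) $ i\<bar> \<le> norm (x - c)" by (rule component_le_norm_cart)
        also have "\<dots> < 1 / (2 * real m)" using x by (simp add: dist_norm norm_minus_commute)
        finally have "\<bar>x $ i * real m - (real (k i) + 1 / 2)\<bar> < 1 / 2"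
          using m0 by (simp add: k(2) g_def abs_less_iff field_simps)
        moreover have "k i < m"
          using k(1) by auto
        then have "real (k i) + 1 \<le> real m"
          by linarith
        ultimately have "0 \<le> x $ i * real m" "x $ i * real m \<le> real m"
          by linarith+
        then show ?thesis using m0 by (simp add: zero_le_mult_iff)
      qed
      then show "x \<in> unit_cube"
        by (simp add: unit_cube_def mem_box_cart)
    qed
    show "1 / real m \<le> dist c c'" if "c \<in> g ` ?K" "c' \<in> g ` ?K" "c \<noteq> c'" for c c'
      using that by (auto intro!: diff)
  qed
qed

lemma bump_family_exists:
  assumes m: "1 \<le> m"
  obtains a :: "real^'d" and C where "bump_family a C"
    "unit_ball_vol (real CARD('d)) / (1024 * 8 ^ CARD('d)) / (real m)\<^sup>2
      \<le> (\<integral>u. (bump a u)\<^sup>2 \<partial>lborel) * real (card C)"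
    "(\<integral>u. (bump a u)\<^sup>2 \<partial>lborel) \<le> unit_ball_vol (real CARD('d)) / real m ^ (CARD('d) + 2)"
    "(\<integral>u. \<bar>bump a u\<bar> \<partial>lborel) \<le> unit_ball_vol (real CARD('d)) / real m ^ (CARD('d) + 1)"
proof -
  obtain C :: "(real^'d) set" where C: "finite C" "card C = m ^ CARD('d)"
    "\<And>c. c \<in> C \<Longrightarrow> ball c (1 / (2 * real m)) \<subseteq> unit_cube"
    "\<And>c c'. c \<in> C \<Longrightarrow> c' \<in> C \<Longrightarrow> c \<noteq> c' \<Longrightarrow> 1 / real m \<le> dist c c'"
    using cube_grid[OF m] by blast
  have m0: "1 \<le> real m" using m by simp
  \<comment> \<open>With this length \<open>2 * norm a\<close> is the radius of the grid balls and
    \<open>4 * norm a\<close> the grid spacing.\<close>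
  obtain a :: "real^'d" where a: "norm a = 1 / (4 * real m)"
    using vector_choose_size[of "1 / (4 * real m)"] m0 by auto
  let ?V = "unit_ball_vol (real CARD('d))"
  have V: "0 \<le> ?V" by simp
  have half: "(1 / (2 * real m)) ^ CARD('d) \<le> (1 / real m) ^ CARD('d)"
    using m0 by (intro power_mono) (auto simp: field_simps)
  show thesis
  proof
    show "bump_family a C"
      using C m0 by unfold_locales (auto simp: a field_simps)
    \<comment> \<open>Here \<open>norm a / 8 = 1 / (32 * real m)\<close> accounts for 1024 and
      \<open>norm a / 2 = 1 / (8 * real m)\<close> for the power of 8; the number of cells cancels
      the remaining power of \<open>m\<close>.\<close>
    have "?V / (1024 * 8 ^ CARD('d)) / (real m)\<^sup>2
        = (norm a / 8)\<^sup>2 * (?V * (norm a / 2) ^ DIM(real^'d)) * real (card C)"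
      using m0 by (simp add: a C(2) power_divide power_mult_distrib field_simps)
    also have "\<dots> \<le> (\<integral>u. (bump a u)\<^sup>2 \<partial>lborel) * real (card C)"
      using integral_bump_square_ge[of a] by (intro mult_right_mono) simp_all
    finally show "?V / (1024 * 8 ^ CARD('d)) / (real m)\<^sup>2
        \<le> (\<integral>u. (bump a u)\<^sup>2 \<partial>lborel) * real (card C)" .
    have le: "(\<integral>u. \<bar>bump a u\<bar> ^ k \<partial>lborel) \<le> ?V / real m ^ (CARD('d) + k)" if "0 < k" for k
    proof -
      \<comment> \<open>Both height and radius are crudely bounded by \<open>1 / real m\<close>;
        only the order in \<open>m\<close> matters.\<close>
      have "norm a / 4 \<le> 1 / real m" using m0 by (simp add: a field_simps)
      then have "(norm a / 4) ^ k * (?V * (2 * norm a) ^ DIM(real^'d))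
          \<le> (1 / real m) ^ k * (?V * (1 / real m) ^ CARD('d))"
        using half V by (auto intro!: mult_mono power_mono mult_left_mono simp: a)
      also have "\<dots> = ?V / real m ^ (CARD('d) + k)"
        by (simp add: power_divide power_add field_simps)
      finally show ?thesis
        using integral_abs_bump_power_le[OF that, of a] by simp
    qed
    show "(\<integral>u. (bump a u)\<^sup>2 \<partial>lborel) \<le> ?V / real m ^ (CARD('d) + 2)"
      using le[of 2] by simp
    show "(\<integral>u. \<bar>bump a u\<bar> \<partial>lborel) \<le> ?V / real m ^ (CARD('d) + 1)"
      using le[of 1] by simp
  qed
qed

text \<open>Takes \<open>m\<close> as \<open>X powr (1 / real k)\<close> rounded up. Since
  \<open>X \<ge> 1\<close>, rounding at most doubles it, which costs the factor 4 after
  squaring.\<close>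

lemma resolution_exists:
  fixes X :: real
  assumes X: "1 \<le> X" and k: "1 \<le> k"
  obtains m :: nat where "1 \<le> m" "X \<le> real m ^ k" "1 / X powr (2 / real k) / 4 \<le> 1 / (real m)\<^sup>2"
proof
  define y where "y = X powr (1 / real k)"
  define m where "m = nat \<lceil>y\<rceil>"
  have y: "1 \<le> y" unfolding y_def using X by (intro ge_one_powr_ge_zero) auto
  have ym: "y \<le> real m" and my: "real m \<le> 2 * y"
    using y unfolding m_def by linarith+
  show "1 \<le> m" using y ym by linarith
  have "X = y ^ k"
    unfolding y_def using X k by (simp add: powr_realpow[symmetric] powr_powr)
  also have "\<dots> \<le> real m ^ k" using y ym by (intro power_mono) auto
  finally show "X \<le> real m ^ k" .
  have y2: "y\<^sup>2 = X powr (2 / real k)"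
    unfolding y_def using X by (simp add: powr_realpow[symmetric] powr_powr)
  have "(real m)\<^sup>2 \<le> (2 * y)\<^sup>2" using my by (intro power_mono) auto
  then show "1 / X powr (2 / real k) / 4 \<le> 1 / (real m)\<^sup>2"
    unfolding y2[symmetric] using y ym by (simp add: field_simps)
qed

section \<open>Constants and the two rates\<close>

lemma one_plus_power_le_exp:
  fixes x :: real
  assumes "0 \<le> x" "real n * x \<le> y"
  shows "(1 + x) ^ n \<le> exp y"
proof -
  have "(1 + x) ^ n \<le> exp x ^ n"
    using assms(1) by (intro power_mono exp_ge_add_one_self) auto
  also have "\<dots> = exp (real n * x)"
    by (simp add: exp_of_nat_mult)
  finally show ?thesis
    using assms(2) by (meson exp_le_cancel_iff order_trans)
qed

text \<open>The first quotient is the squared norm of all bumps together, up to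
  \<open>1 / (real m)^2\<close>. The 64 is 16 from Assouad times 4 from rounding, and the
  exponential bounds \<open>B\<close> in both regimes.\<close>

definition minimax_constant :: "'d::finite itself \<Rightarrow> real"
  where "minimax_constant _ =
    unit_ball_vol (real CARD('d)) / (1024 * 8 ^ CARD('d)) / (64 * exp (2 * unit_ball_vol (real CARD('d))))"

lemma minimax_constant_pos: "0 < minimax_constant TYPE('d::finite)"
  by (simp add: minimax_constant_def)

lemma minimax_constant_le:
  fixes s N B X M :: real
  assumes sN: "unit_ball_vol (real CARD('d)) / (1024 * 8 ^ CARD('d)) / M \<le> s * N" "0 \<le> s * N"
    and X: "1 / X / 4 \<le> 1 / M"
    and B: "0 < B" "B \<le> exp (2 * unit_ball_vol (real CARD('d::finite)))"
  shows "minimax_constant TYPE('d) * (1 / X) \<le> s * N / (16 * B)"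
proof -
  let ?V = "unit_ball_vol (real CARD('d))"
  define \<kappa> where "\<kappa> = ?V / (1024 * 8 ^ CARD('d))"
  have "minimax_constant TYPE('d) * (1 / X) = \<kappa> * (1 / X / 4) / (16 * exp (2 * ?V))"
    by (simp add: minimax_constant_def \<kappa>_def)
  also have "\<dots> \<le> \<kappa> * (1 / M) / (16 * exp (2 * ?V))"
    using X by (intro divide_right_mono mult_left_mono) (auto simp: \<kappa>_def)
  also have "\<dots> \<le> s * N / (16 * exp (2 * ?V))"
    using sN(1) by (intro divide_right_mono) (auto simp: \<kappa>_def)
  also have "\<dots> \<le> s * N / (16 * B)"
    using sN(2) B by (intro divide_left_mono) auto
  finally show ?thesis .
qed

text \<open>The choice \<open>real m ^ (CARD('d) + 2) \<ge> real n\<close> keeps \<open>n\<close>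
  times twice the squared norm of a bump below \<open>2 * ?V\<close>, hence \<open>B\<close> below
  \<open>exp (2 * ?V)\<close>.\<close>

lemma minimax_nonprivate:
  fixes Q :: "(nat \<Rightarrow> real^'d) \<Rightarrow> 'd cube_L2 measure"
  assumes Q: "Q \<in> channels n" and n: "1 \<le> n"
  shows "ennreal (minimax_constant TYPE('d) * (1 / real n powr (2 / (2 + real CARD('d)))))
    \<le> (SUP P\<in>lipschitz_distributions. risk n Q P)"
proof -
  let ?V = "unit_ball_vol (real CARD('d))"
  obtain m where m: "1 \<le> m" "real n \<le> real m ^ (CARD('d) + 2)"
    "1 / real n powr (2 / real (CARD('d) + 2)) / 4 \<le> 1 / (real m)\<^sup>2"
    using resolution_exists[of "real n" "CARD('d) + 2"] n by auto
  obtain a :: "real^'d" and C where fam: "bump_family a C"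
    and sC: "?V / (1024 * 8 ^ CARD('d)) / (real m)\<^sup>2 \<le> (\<integral>u. (bump a u)\<^sup>2 \<partial>lborel) * real (card C)"
    and s: "(\<integral>u. (bump a u)\<^sup>2 \<partial>lborel) \<le> ?V / real m ^ (CARD('d) + 2)"
    using bump_family_exists[OF m(1), where 'd='d] by metis
  let ?s = "\<integral>u. (bump a u)\<^sup>2 \<partial>lborel"
  have s0: "0 \<le> ?s" by simp
  have "real n * (2 * ?s) \<le> real m ^ (CARD('d) + 2) * (2 * (?V / real m ^ (CARD('d) + 2)))"
    using m s s0 by (intro mult_mono) auto
  also have "\<dots> = 2 * ?V" using m(1) by simp
  finally have "(1 + 2 * ?s) ^ n \<le> exp (2 * ?V)"
    using s0 by (intro one_plus_power_le_exp) auto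
  then have "minimax_constant TYPE('d) * (1 / real n powr (2 / (2 + real CARD('d))))
      \<le> ?s * real (card C) / (16 * (1 + 2 * ?s) ^ n)"
    using m(3) sC s0 by (intro minimax_constant_le) (auto simp: add.commute intro!: zero_less_power add_pos_nonneg)
  then show ?thesis
    by (intro order_trans[OF ennreal_leI bump_family.sup_risk_ge[OF fam Q]])
qed

text \<open>The same balance with the \<open>L^1\<close> norm: \<open>m\<close> is chosen with
  \<open>real m ^ (CARD('d) + 1) \<ge> real n * \<epsilon>\<close>, and for
  \<open>\<epsilon> \<le> 1\<close> the factor \<open>exp \<epsilon> - 1\<close> is of order
  \<open>\<epsilon>\<close>.\<close>

lemma minimax_private:
  fixes Q :: "(nat \<Rightarrow> real^'d) \<Rightarrow> 'd cube_L2 measure"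
  assumes Q: "Q \<in> private_channels n \<epsilon>" and \<epsilon>: "0 \<le> \<epsilon>" "\<epsilon> \<le> 1" and n\<epsilon>: "1 \<le> real n * \<epsilon>"
  shows "ennreal (minimax_constant TYPE('d) * (1 / (real n * \<epsilon>) powr (2 / (1 + real CARD('d)))))
    \<le> (SUP P\<in>lipschitz_distributions. risk n Q P)"
proof -
  let ?V = "unit_ball_vol (real CARD('d))"
  obtain m where m: "1 \<le> m" "real n * \<epsilon> \<le> real m ^ (CARD('d) + 1)"
    "1 / (real n * \<epsilon>) powr (2 / real (CARD('d) + 1)) / 4 \<le> 1 / (real m)\<^sup>2"
    using resolution_exists[of "real n * \<epsilon>" "CARD('d) + 1"] n\<epsilon> by auto
  obtain a :: "real^'d" and C where fam: "bump_family a C"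
    and sC: "?V / (1024 * 8 ^ CARD('d)) / (real m)\<^sup>2 \<le> (\<integral>u. (bump a u)\<^sup>2 \<partial>lborel) * real (card C)"
    and \<tau>: "(\<integral>u. \<bar>bump a u\<bar> \<partial>lborel) \<le> ?V / real m ^ (CARD('d) + 1)"
    using bump_family_exists[OF m(1), where 'd='d] by metis
  let ?s = "\<integral>u. (bump a u)\<^sup>2 \<partial>lborel" and ?\<tau> = "\<integral>u. \<bar>bump a u\<bar> \<partial>lborel"
  have \<tau>0: "0 \<le> ?\<tau>" by simp
  \<comment> \<open>Turns \<open>exp \<epsilon> \<le> 1 + \<epsilon> + \<epsilon>^2\<close> into a
    linear bound.\<close>
  have "\<epsilon>\<^sup>2 \<le> \<epsilon>" using \<epsilon> by (simp add: power2_eq_square mult_left_le)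
  then have exp: "exp \<epsilon> - 1 \<le> 2 * \<epsilon>" using exp_bound[OF \<epsilon>] by linarith
  have nonneg: "0 \<le> ?\<tau> * (exp \<epsilon> - 1)" using \<tau>0 \<epsilon> by simp
  have "real n * (?\<tau> * (exp \<epsilon> - 1)) \<le> real n * (?\<tau> * (2 * \<epsilon>))"
    using exp \<tau>0 by (intro mult_left_mono) auto
  also have "\<dots> = (real n * \<epsilon>) * (2 * ?\<tau>)" by simp
  also have "\<dots> \<le> real m ^ (CARD('d) + 1) * (2 * (?V / real m ^ (CARD('d) + 1)))"
    using m \<tau> \<tau>0 by (intro mult_mono) auto
  also have "\<dots> = 2 * ?V" using m(1) by simp
  finally have "(1 + ?\<tau> * (exp \<epsilon> - 1)) ^ n \<le> exp (2 * ?V)"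
    using nonneg by (intro one_plus_power_le_exp) auto
  then have "minimax_constant TYPE('d) * (1 / (real n * \<epsilon>) powr (2 / (1 + real CARD('d))))
      \<le> ?s * real (card C) / (16 * (1 + ?\<tau> * (exp \<epsilon> - 1)) ^ n)"
    using m(3) sC nonneg by (intro minimax_constant_le) (auto simp: add.commute intro!: zero_less_power add_pos_nonneg)
  then show ?thesis
    by (intro order_trans[OF ennreal_leI bump_family.sup_risk_ge_of_private[OF fam Q \<epsilon>(1)]])
qed

text \<open>The condition \<open>real n * \<epsilon> \<ge> 1\<close> excludes the range where the
  claim would fail: the channel that ignores the data and returns the uniform density is private and
  has risk bounded in terms of the dimension, whereas the second term blows up as
  \<open>real n * \<epsilon>\<close> tends to 0.\<close>

theorem proposition5:
  shows "\<exists>c>0. \<forall>(n::nat) (\<epsilon>::real). n \<ge> 1 \<longrightarrow> \<epsilon> > 0 \<longrightarrow> real n * \<epsilon> \<ge> 1 \<longrightarrow>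
    (INF Q\<in>private_channels n \<epsilon>. SUP P\<in>(lipschitz_distributions :: (real^'d) measure set). risk n Q P)
      \<ge> ennreal (c * (1 / real n powr (2 / (2 + real CARD('d)))
                    + 1 / (real n * \<epsilon>) powr (2 / (1 + real CARD('d)))))"
\<comment> \<open>Half the constant suffices because a sum of two terms is at most twice their
  maximum.\<close>
proof (intro exI[of _ "minimax_constant TYPE('d) / 2"] conjI allI impI INF_greatest)
  show "0 < minimax_constant TYPE('d) / 2"
    using minimax_constant_pos by simp
  fix n :: nat and \<epsilon> :: real and Q :: "(nat \<Rightarrow> real^'d) \<Rightarrow> 'd cube_L2 measure"
  assume n: "1 \<le> n" and \<epsilon>: "0 < \<epsilon>" and n\<epsilon>: "1 \<le> real n * \<epsilon>" and Q: "Q \<in> private_channels n \<epsilon>"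
  let ?R = "SUP P\<in>lipschitz_distributions. risk n Q P"
  let ?c = "minimax_constant TYPE('d)"
  let ?x = "1 / real n powr (2 / (2 + real CARD('d)))"
    and ?y = "1 / (real n * \<epsilon>) powr (2 / (1 + real CARD('d)))"
  have x: "ennreal (?c * ?x) \<le> ?R"
    using Q n by (intro minimax_nonprivate) (auto simp: private_channels_def)
  have y: "ennreal (?c * ?y) \<le> ?R"
  proof (cases "\<epsilon> \<le> 1")
    case True
    with Q \<epsilon> n\<epsilon> show ?thesis by (intro minimax_private) auto
  next
    case False
    \<comment> \<open>For \<open>\<epsilon> > 1\<close> both the larger exponent and the larger base
      make the private term smaller than the nonprivate one.\<close>
    have "real n powr (2 / (2 + real CARD('d))) \<le> real n powr (2 / (1 + real CARD('d)))"
      using n by (intro powr_mono divide_left_mono) auto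
    also have "\<dots> \<le> (real n * \<epsilon>) powr (2 / (1 + real CARD('d)))"
      using n False by (intro powr_mono2) auto
    finally have "?y \<le> ?x"
      using n \<epsilon> by (intro divide_left_mono mult_pos_pos) auto
    then have "?c * ?y \<le> ?c * ?x"
      using minimax_constant_pos[where 'd='d] by (intro mult_left_mono) auto
    then show ?thesis using x by (meson ennreal_leI order_trans)
  qed
  have "?c / 2 * (?x + ?y) \<le> max (?c * ?x) (?c * ?y)"
    unfolding distrib_left by linarith
  then have "ennreal (?c / 2 * (?x + ?y)) \<le> ennreal (max (?c * ?x) (?c * ?y))"
    by (rule ennreal_leI)
  also have "\<dots> \<le> ?R"
    using x y by (simp add: max_def)
  finally show "ennreal (?c / 2 * (?x + ?y)) \<le> ?R" .
qed

end
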